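(* Let $\mathbb{X}$ be a Cartesian closed left additive category with an exponentiable linearizing combinator $\mathsf{L}$. Then: (i) $\mathbb{X}$ comes equipped with a closed system of linearizing combinators $\mathsf{L}^C$ defined on a map $f: C \times A \to B$ by $$\mathsf{L}^C[f] = \lambda^{-1}\left( \mathsf{L}[\lambda(f)] \right),$$ and the resulting induced linearizing combinator $f\mapsto\langle 0,1\rangle\,\mathsf{L}^\top[\pi_1 f]$ (for $f:A\to B$, with $\langle 0,1\rangle:A\to\top\times A$ and $\pi_1:\top\times A\to A$) is precisely $\mathsf{L}$; (ii) $\mathbb{X}$ is a Cartesian closed differential category with differential combinator $\mathsf{D}_\mathsf{L}$ defined on a map $f: A \to B$ by $$\mathsf{D}_\mathsf{L}[f] = \lambda^{-1}\left( \mathsf{L}[\lambda(\oplus_A f)] \right),$$ and furthermore this differential combinator is precisely the differential combinator $f\mapsto\mathsf{L}^A[\oplus_A f]$ induced by the system $\mathsf{L}^C$ of (i). Therefore, a Cartesian closed left additive category with an exponentiable linearizing combinator is a Cartesian closed differential category.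
   Context: Composition is in diagrammatic order: $fg$ means first $f$, then $g$; identities are written $1$. A left additive category is a category whose hom-sets are commutative monoids $(+,0)$ with $f(g+h)=fg+fh$ and $f0=0$. A map $f$ is additive if $0f=0$ and $(g+h)f=gf+hf$ for all $g,h$. A Cartesian left additive category is a left additive category with (chosen) finite products whose projections $\pi_0,\pi_1$ are additive; $\langle -,-\rangle$ is pairing, $f\times g=\langle \pi_0 f,\pi_1 g\rangle$, $\top$ is the terminal object. Put $\oplus_A:=\pi_0+\pi_1:A\times A\to A$; $\tau:=\langle\pi_1,\pi_0\rangle:A\times B\to B\times A$; $\ell_{A,B,C,D}:=\langle 1,0\rangle\times\langle 0,1\rangle: A\times D\to (A\times B)\times(C\times D)$; $c_{A,B,C,D}:=\langle \pi_0\times\pi_0,\pi_1\times\pi_1\rangle:(A\times B)\times(C\times D)\to(A\times C)\times(B\times D)$ (subscripts omitted). In a Cartesian closed category: $[C,A]$ is the internal hom, $\epsilon:C\times[C,A]\to A$ evaluation, $\lambda(f):A\to[C,B]$ the curry of $f:C\times A\to B$ (unique with $(1\times\lambda(f))\epsilon=f$), and $\lambda^{-1}(g)=(1\times g)\epsilon$. For $f:C\to D$, $g:A\to B$ put $[f,g]:=\lambda((f\times 1)\epsilon g):[D,A]\to[C,B]$. Put $\eta:=\lambda(\pi_1):A\to[C,A]$ and $\mu:=\lambda(\langle\pi_0,\epsilon\rangle\epsilon):[C,[C,A]]\to[C,A]$. A Cartesian closed left additive category is a Cartesian left additive category that is Cartesian closed with $\lambda(f+g)=\lambda(f)+\lambda(g)$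 and $\lambda(0)=0$. A differential combinator $\mathsf{D}$ on a Cartesian left additive category is a family of operators $\mathsf{D}:\mathbb{X}(A,B)\to\mathbb{X}(A\times A,B)$ such that: [CD.1] $\mathsf{D}[f+g]=\mathsf{D}[f]+\mathsf{D}[g]$, $\mathsf{D}[0]=0$; [CD.2] $(1\times\oplus_A)\mathsf{D}[f]=(1\times\pi_0)\mathsf{D}[f]+(1\times\pi_1)\mathsf{D}[f]$, $\langle 1,0\rangle\mathsf{D}[f]=0$; [CD.3] $\mathsf{D}[1]=\pi_1$, $\mathsf{D}[\pi_0]=\pi_1\pi_0$, $\mathsf{D}[\pi_1]=\pi_1\pi_1$; [CD.4] $\mathsf{D}[\langle f,g\rangle]=\langle\mathsf{D}[f],\mathsf{D}[g]\rangle$; [CD.5] $\mathsf{D}[fg]=\langle\pi_0 f,\mathsf{D}[f]\rangle\mathsf{D}[g]$; [CD.6] $\ell\,\mathsf{D}[\mathsf{D}[f]]=\mathsf{D}[f]$; [CD.7] $c\,\mathsf{D}[\mathsf{D}[f]]=\mathsf{D}[\mathsf{D}[f]]$. For $f:C\times A\to B$ put $\mathsf{D}^C[f]:=\langle 1\times\pi_0,0\times\pi_1\rangle\mathsf{D}[f]: C\times(A\times A)\to B$. A Cartesian closed differential category is a Cartesian closed left additive category with a differential combinator satisfying [CD.$\lambda$]: $\mathsf{D}[\lambda(f)]=\lambda(\mathsf{D}^C[f])$ for every $f:C\times A\to B$; equivalently (known) [CD.ev]: $\mathsf{D}^C[\epsilon]=(1\times\pi_1)\epsilon$ for every $\epsilon:C\times[C,A]\to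 A$. A linearizing combinator $\mathsf{L}$ on a Cartesian left additive category is a family of operators $\mathsf{L}:\mathbb{X}(A,B)\to\mathbb{X}(A,B)$ such that: [L.1] $\mathsf{L}[f+g]=\mathsf{L}[f]+\mathsf{L}[g]$, $\mathsf{L}[0]=0$; [L.2] $\mathsf{L}[f]$ is additive; [L.3] $\mathsf{L}[1]=1$, $\mathsf{L}[\pi_0]=\pi_0$, $\mathsf{L}[\pi_1]=\pi_1$; [L.4] $\mathsf{L}[\langle f,g\rangle]=\langle\mathsf{L}[f],\mathsf{L}[g]\rangle$; [L.5] $\mathsf{L}[fg]=\mathsf{L}[f]\,\mathsf{L}[(1+0f)g]$; [L.6] $\mathsf{L}[\mathsf{L}[f]]=\mathsf{L}[f]$. It is exponentiable (also called exponential, on a Cartesian closed left additive category) if moreover: [EL.1] $\mathsf{L}[\eta]=\eta$, $\mathsf{L}[\mu]=\mu$; [EL.2] $\mathsf{L}[[f,g]]=[f,\mathsf{L}[g]]$; [EL.3] for every $f:A\times B\to C$, $\mathsf{L}_0[\mathsf{L}_1[f]]=\mathsf{L}_1[\mathsf{L}_0[f]]$, where $\mathsf{L}_0[f]:=\tau\lambda^{-1}(\mathsf{L}[\lambda(\tau f)])$ and $\mathsf{L}_1[f]:=\lambda^{-1}(\mathsf{L}[\lambda(f)])$. A system of linearizing combinators on $\mathbb{X}$ is a family, indexed by objects $C$, of operators $\mathsf{L}^C:\mathbb{X}(C\times A,B)\to\mathbb{X}(C\times A,B)$ such that: [L.1] $\mathsf{L}^{C}[f+g]=\mathsf{L}^{C}[f]+\mathsf{L}^{C}[g]$,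 $\mathsf{L}^{C}[0]=0$; [L.2] $(1\times\oplus_A)\mathsf{L}^{C}[f]=(1\times\pi_0)\mathsf{L}^{C}[f]+(1\times\pi_1)\mathsf{L}^{C}[f]$, $\langle\pi_0,0\rangle\mathsf{L}^{C}[f]=0$; [L.3] $\mathsf{L}^{C}[\pi_1]=\pi_1$, $\mathsf{L}^{C}[\pi_1\pi_0]=\pi_1\pi_0$, $\mathsf{L}^{C}[\pi_1\pi_1]=\pi_1\pi_1$; [L.4] $\mathsf{L}^{C}[\langle f,g\rangle]=\langle\mathsf{L}^{C}[f],\mathsf{L}^{C}[g]\rangle$; [L.5] $\mathsf{L}^{C}[\langle\pi_0,f\rangle g]=\langle\pi_0,\mathsf{L}^{C}[f]\rangle\,\mathsf{L}^{C}[\langle\pi_0,\pi_1+\langle\pi_0,0\rangle f\rangle g]$; [L.6] $\mathsf{L}^{C}[\mathsf{L}^{C}[f]]=\mathsf{L}^{C}[f]$; [L.7] with $\alpha=\langle 1\times\pi_0,\pi_1\pi_1\rangle:C\times(A\times B)\to(C\times A)\times B$ and $\beta=\langle 1\times\pi_1,\pi_1\pi_0\rangle:C\times(A\times B)\to(C\times B)\times A$, and for $f:C\times(A\times B)\to D$, $\mathsf{L}^C_0[f]:=\beta\,\mathsf{L}^{C\times B}[\beta^{-1}f]$, $\mathsf{L}^C_1[f]:=\alpha\,\mathsf{L}^{C\times A}[\alpha^{-1}f]$, one has $\mathsf{L}^C_1[\mathsf{L}^C_0[f]]=\mathsf{L}^C_0[\mathsf{L}^C_1[f]]$; [L.8]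 for every $h:C'\to C$ and $f:C\times A\to B$, $(h\times 1)\mathsf{L}^{C}[f]=\mathsf{L}^{C'}[(h\times 1)f]$. It is closed if moreover [L.$\lambda$]: for every $f:C\times A\to B$, $\langle 0,1\rangle\mathsf{L}^\top[\pi_1\lambda(f)]=\lambda(\mathsf{L}^C[f])$. *)

theory Defs
  imports Main
begin

(* Composition is in diagrammatic order: f \<cdot> g is first f, then g. Every arrow determines its
   domain and codomain. Since a product object need not determine its factors, nor an exponential
   its base and exponent, these are passed as arguments wherever an operation depends on them. *)

section \<open>Categories\<close>

record ('o, 'm) cat_data =
  Obj :: "'o set"
  Arr :: "'m set"
  Dom :: "'m \<Rightarrow> 'o"
  Cod :: "'m \<Rightarrow> 'o"
  Ident :: "'o \<Rightarrow> 'm"  ("\<one>\<index>")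
  Comp :: "'m \<Rightarrow> 'm \<Rightarrow> 'm"  (infixl "\<cdot>\<index>" 70)

definition hom :: "('o, 'm, 'x) cat_data_scheme \<Rightarrow> 'o \<Rightarrow> 'o \<Rightarrow> 'm set"
  where "hom X A B = {f \<in> Arr X. Dom X f = A \<and> Cod X f = B}"

locale category =
  fixes X :: "('o, 'm, 'x) cat_data_scheme" (structure)
  assumes Dom_Obj: "f \<in> Arr X \<Longrightarrow> Dom X f \<in> Obj X"
    and Cod_Obj: "f \<in> Arr X \<Longrightarrow> Cod X f \<in> Obj X"
    and Ident_hom: "A \<in> Obj X \<Longrightarrow> \<one> A \<in> hom X A A"
    and Comp_hom: "f \<in> hom X A B \<Longrightarrow> g \<in> hom X B C \<Longrightarrow> f \<cdot> g \<in> hom X A C"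
    and Ident_left: "f \<in> hom X A B \<Longrightarrow> \<one> A \<cdot> f = f"
    and Ident_right: "f \<in> hom X A B \<Longrightarrow> f \<cdot> \<one> B = f"
    and Comp_assoc: "f \<in> hom X A B \<Longrightarrow> g \<in> hom X B C \<Longrightarrow> h \<in> hom X C D
          \<Longrightarrow> (f \<cdot> g) \<cdot> h = f \<cdot> (g \<cdot> h)"

definition (in category) iso_inv :: "'m \<Rightarrow> 'm"
  where "iso_inv f = (THE g. g \<in> hom X (Cod X f) (Dom X f)
                        \<and> f \<cdot> g = \<one> (Dom X f) \<and> g \<cdot> f = \<one> (Cod X f))"

section \<open>Left additive categories\<close>

record ('o, 'm) left_additive_data = "('o, 'm) cat_data" +
  Zero :: "'o \<Rightarrow> 'o \<Rightarrow> 'm"  ("\<zero>\<index>")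
  Add :: "'m \<Rightarrow> 'm \<Rightarrow> 'm"  (infixl "\<oplus>\<index>" 65)

locale left_additive_category = category X
  for X :: "('o, 'm, 'x) left_additive_data_scheme" (structure) +
  assumes Zero_hom: "A \<in> Obj X \<Longrightarrow> B \<in> Obj X \<Longrightarrow> \<zero> A B \<in> hom X A B"
    and Add_hom: "f \<in> hom X A B \<Longrightarrow> g \<in> hom X A B \<Longrightarrow> f \<oplus> g \<in> hom X A B"
    and Add_assoc: "f \<in> hom X A B \<Longrightarrow> g \<in> hom X A B \<Longrightarrow> h \<in> hom X A B
          \<Longrightarrow> (f \<oplus> g) \<oplus> h = f \<oplus> (g \<oplus> h)"
    and Add_commute: "f \<in> hom X A B \<Longrightarrow> g \<in> hom X A B \<Longrightarrow> f \<oplus> g = g \<oplus> f"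
    and Add_Zero: "f \<in> hom X A B \<Longrightarrow> f \<oplus> \<zero> A B = f"
    and Comp_Add: "f \<in> hom X A B \<Longrightarrow> g \<in> hom X B C \<Longrightarrow> h \<in> hom X B C
          \<Longrightarrow> f \<cdot> (g \<oplus> h) = f \<cdot> g \<oplus> f \<cdot> h"
    and Comp_Zero: "f \<in> hom X A B \<Longrightarrow> C \<in> Obj X \<Longrightarrow> f \<cdot> \<zero> B C = \<zero> A C"

definition (in left_additive_category) additive :: "'m \<Rightarrow> bool"
  where "additive f \<longleftrightarrow> f \<in> Arr X \<and>
    (\<forall>Z \<in> Obj X. \<zero> Z (Dom X f) \<cdot> f = \<zero> Z (Cod X f) \<and>
      (\<forall>g \<in> hom X Z (Dom X f). \<forall>h \<in> hom X Z (Dom X f). (g \<oplus> h) \<cdot> f = g \<cdot> f \<oplus> h \<cdot> f))"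

section \<open>Cartesian left additive categories\<close>

record ('o, 'm) cartesian_data = "('o, 'm) left_additive_data" +
  Prod :: "'o \<Rightarrow> 'o \<Rightarrow> 'o"  (infixr "\<otimes>\<index>" 80)
  Proj0 :: "'o \<Rightarrow> 'o \<Rightarrow> 'm"  ("\<pi>\<^sub>0\<index>")
  Proj1 :: "'o \<Rightarrow> 'o \<Rightarrow> 'm"  ("\<pi>\<^sub>1\<index>")
  Pair :: "'m \<Rightarrow> 'm \<Rightarrow> 'm"  ("\<langle>_, _\<rangle>\<index>")
  Top :: "'o"  ("\<top>\<index>")

locale cartesian_left_additive_category = left_additive_category X
  for X :: "('o, 'm, 'x) cartesian_data_scheme" (structure) +
  assumes Prod_Obj: "A \<in> Obj X \<Longrightarrow> B \<in> Obj X \<Longrightarrow> A \<otimes> B \<in> Obj X"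
    and Proj0_hom: "A \<in> Obj X \<Longrightarrow> B \<in> Obj X \<Longrightarrow> \<pi>\<^sub>0 A B \<in> hom X (A \<otimes> B) A"
    and Proj1_hom: "A \<in> Obj X \<Longrightarrow> B \<in> Obj X \<Longrightarrow> \<pi>\<^sub>1 A B \<in> hom X (A \<otimes> B) B"
    and Pair_hom: "f \<in> hom X Z A \<Longrightarrow> g \<in> hom X Z B \<Longrightarrow> \<langle>f, g\<rangle> \<in> hom X Z (A \<otimes> B)"
    and Pair_Proj0: "f \<in> hom X Z A \<Longrightarrow> g \<in> hom X Z B \<Longrightarrow> \<langle>f, g\<rangle> \<cdot> \<pi>\<^sub>0 A B = f"
    and Pair_Proj1: "f \<in> hom X Z A \<Longrightarrow> g \<in> hom X Z B \<Longrightarrow> \<langle>f, g\<rangle> \<cdot> \<pi>\<^sub>1 A B = g"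
    and Pair_unique: "A \<in> Obj X \<Longrightarrow> B \<in> Obj X \<Longrightarrow> h \<in> hom X Z (A \<otimes> B)
          \<Longrightarrow> \<langle>h \<cdot> \<pi>\<^sub>0 A B, h \<cdot> \<pi>\<^sub>1 A B\<rangle> = h"
    and Top_Obj: "\<top> \<in> Obj X"
    and Top_terminal: "A \<in> Obj X \<Longrightarrow> \<exists>!f. f \<in> hom X A \<top>"
    and Proj0_additive: "A \<in> Obj X \<Longrightarrow> B \<in> Obj X \<Longrightarrow> additive (\<pi>\<^sub>0 A B)"
    and Proj1_additive: "A \<in> Obj X \<Longrightarrow> B \<in> Obj X \<Longrightarrow> additive (\<pi>\<^sub>1 A B)"

context cartesian_left_additive_category
begin

definition prod_map :: "'m \<Rightarrow> 'm \<Rightarrow> 'm"  (infixr "\<boxtimes>" 75)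
  where "f \<boxtimes> g = \<langle>\<pi>\<^sub>0 (Dom X f) (Dom X g) \<cdot> f, \<pi>\<^sub>1 (Dom X f) (Dom X g) \<cdot> g\<rangle>"

definition sum_map :: "'o \<Rightarrow> 'm"
  where "sum_map A = \<pi>\<^sub>0 A A \<oplus> \<pi>\<^sub>1 A A"

definition twist :: "'o \<Rightarrow> 'o \<Rightarrow> 'm"
  where "twist A B = \<langle>\<pi>\<^sub>1 A B, \<pi>\<^sub>0 A B\<rangle>"

definition lift_map :: "'o \<Rightarrow> 'o \<Rightarrow> 'o \<Rightarrow> 'o \<Rightarrow> 'm"
  where "lift_map A B C D = \<langle>\<one> A, \<zero> A B\<rangle> \<boxtimes> \<langle>\<zero> D C, \<one> D\<rangle>"

definition interchange :: "'o \<Rightarrow> 'o \<Rightarrow> 'o \<Rightarrow> 'o \<Rightarrow> 'm"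
  where "interchange A B C D = \<langle>\<pi>\<^sub>0 A B \<boxtimes> \<pi>\<^sub>0 C D, \<pi>\<^sub>1 A B \<boxtimes> \<pi>\<^sub>1 C D\<rangle>"

end

section \<open>Cartesian closed left additive categories\<close>

record ('o, 'm) closed_data = "('o, 'm) cartesian_data" +
  Exp :: "'o \<Rightarrow> 'o \<Rightarrow> 'o"  ("\<^bold>[_, _\<^bold>]\<index>")
  Eval :: "'o \<Rightarrow> 'o \<Rightarrow> 'm"  ("\<epsilon>\<index>")
  Curry :: "'o \<Rightarrow> 'o \<Rightarrow> 'm \<Rightarrow> 'm"  ("\<Lambda>\<index>")

locale cartesian_closed_left_additive_category = cartesian_left_additive_category X
  for X :: "('o, 'm, 'x) closed_data_scheme" (structure) +
  assumes Exp_Obj: "C \<in> Obj X \<Longrightarrow> A \<in> Obj X \<Longrightarrow> \<^bold>[C, A\<^bold>] \<in> Obj X"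
    and Eval_hom: "C \<in> Obj X \<Longrightarrow> A \<in> Obj X \<Longrightarrow> \<epsilon> C A \<in> hom X (C \<otimes> \<^bold>[C, A\<^bold>]) A"
    and Curry_hom: "C \<in> Obj X \<Longrightarrow> A \<in> Obj X \<Longrightarrow> f \<in> hom X (C \<otimes> A) B
          \<Longrightarrow> \<Lambda> C A f \<in> hom X A \<^bold>[C, B\<^bold>]"
    and Curry_Eval: "C \<in> Obj X \<Longrightarrow> A \<in> Obj X \<Longrightarrow> f \<in> hom X (C \<otimes> A) B
          \<Longrightarrow> (\<one> C \<boxtimes> \<Lambda> C A f) \<cdot> \<epsilon> C B = f"
    and Curry_unique: "C \<in> Obj X \<Longrightarrow> B \<in> Obj X \<Longrightarrow> f \<in> hom X (C \<otimes> A) B \<Longrightarrow> g \<in> hom X A \<^bold>[C, B\<^bold>]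
          \<Longrightarrow> (\<one> C \<boxtimes> g) \<cdot> \<epsilon> C B = f \<Longrightarrow> g = \<Lambda> C A f"
    and Curry_Add: "C \<in> Obj X \<Longrightarrow> A \<in> Obj X \<Longrightarrow> f \<in> hom X (C \<otimes> A) B \<Longrightarrow> g \<in> hom X (C \<otimes> A) B
          \<Longrightarrow> \<Lambda> C A (f \<oplus> g) = \<Lambda> C A f \<oplus> \<Lambda> C A g"
    and Curry_Zero: "C \<in> Obj X \<Longrightarrow> A \<in> Obj X \<Longrightarrow> B \<in> Obj X
          \<Longrightarrow> \<Lambda> C A (\<zero> (C \<otimes> A) B) = \<zero> A \<^bold>[C, B\<^bold>]"

context cartesian_closed_left_additive_category
begin

(* inverse of currying, for g : A \<rightarrow> [C, B] *)
definition uncurry :: "'o \<Rightarrow> 'o \<Rightarrow> 'm \<Rightarrow> 'm"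
  where "uncurry C B g = (\<one> C \<boxtimes> g) \<cdot> \<epsilon> C B"

(* [f, g] : [D, A] \<rightarrow> [C, B] for f : C \<rightarrow> D and g : A \<rightarrow> B *)
definition exp_map :: "'m \<Rightarrow> 'm \<Rightarrow> 'm"
  where "exp_map f g = (let C = Dom X f; D = Cod X f; A = Dom X g in
           \<Lambda> C \<^bold>[D, A\<^bold>] ((f \<boxtimes> \<one> \<^bold>[D, A\<^bold>]) \<cdot> \<epsilon> D A \<cdot> g))"

definition exp_unit :: "'o \<Rightarrow> 'o \<Rightarrow> 'm"
  where "exp_unit C A = \<Lambda> C A (\<pi>\<^sub>1 C A)"

definition exp_mult :: "'o \<Rightarrow> 'o \<Rightarrow> 'm"
  where "exp_mult C A = \<Lambda> C \<^bold>[C, \<^bold>[C, A\<^bold>]\<^bold>]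
           (\<langle>\<pi>\<^sub>0 C \<^bold>[C, \<^bold>[C, A\<^bold>]\<^bold>], \<epsilon> C \<^bold>[C, A\<^bold>]\<rangle> \<cdot> \<epsilon> C A)"

end

section \<open>Differential combinators\<close>

locale differential_combinator = cartesian_left_additive_category X
  for X :: "('o, 'm, 'x) cartesian_data_scheme" (structure) +
  fixes \<D> :: "'m \<Rightarrow> 'm"
  assumes CD_hom: "f \<in> hom X A B \<Longrightarrow> \<D> f \<in> hom X (A \<otimes> A) B"
    and CD1_Add: "f \<in> hom X A B \<Longrightarrow> g \<in> hom X A B \<Longrightarrow> \<D> (f \<oplus> g) = \<D> f \<oplus> \<D> g"
    and CD1_Zero: "A \<in> Obj X \<Longrightarrow> B \<in> Obj X \<Longrightarrow> \<D> (\<zero> A B) = \<zero> (A \<otimes> A) B"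
    and CD2_Add: "f \<in> hom X A B \<Longrightarrow>
          (\<one> A \<boxtimes> sum_map A) \<cdot> \<D> f = (\<one> A \<boxtimes> \<pi>\<^sub>0 A A) \<cdot> \<D> f \<oplus> (\<one> A \<boxtimes> \<pi>\<^sub>1 A A) \<cdot> \<D> f"
    and CD2_Zero: "f \<in> hom X A B \<Longrightarrow> \<langle>\<one> A, \<zero> A A\<rangle> \<cdot> \<D> f = \<zero> A B"
    and CD3_Ident: "A \<in> Obj X \<Longrightarrow> \<D> (\<one> A) = \<pi>\<^sub>1 A A"
    and CD3_Proj0: "A \<in> Obj X \<Longrightarrow> B \<in> Obj X \<Longrightarrow>
          \<D> (\<pi>\<^sub>0 A B) = \<pi>\<^sub>1 (A \<otimes> B) (A \<otimes> B) \<cdot> \<pi>\<^sub>0 A B"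
    and CD3_Proj1: "A \<in> Obj X \<Longrightarrow> B \<in> Obj X \<Longrightarrow>
          \<D> (\<pi>\<^sub>1 A B) = \<pi>\<^sub>1 (A \<otimes> B) (A \<otimes> B) \<cdot> \<pi>\<^sub>1 A B"
    and CD4: "f \<in> hom X Z A \<Longrightarrow> g \<in> hom X Z B \<Longrightarrow> \<D> \<langle>f, g\<rangle> = \<langle>\<D> f, \<D> g\<rangle>"
    and CD5: "f \<in> hom X A B \<Longrightarrow> g \<in> hom X B C \<Longrightarrow> \<D> (f \<cdot> g) = \<langle>\<pi>\<^sub>0 A A \<cdot> f, \<D> f\<rangle> \<cdot> \<D> g"
    and CD6: "f \<in> hom X A B \<Longrightarrow> lift_map A A A A \<cdot> \<D> (\<D> f) = \<D> f"
    and CD7: "f \<in> hom X A B \<Longrightarrow> interchange A A A A \<cdot> \<D> (\<D> f) = \<D> (\<D> f)"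

(* partial derivative in the second argument, for f : C \<otimes> A \<rightarrow> B *)
definition (in cartesian_left_additive_category) partial_deriv ::
    "('m \<Rightarrow> 'm) \<Rightarrow> 'o \<Rightarrow> 'o \<Rightarrow> 'm \<Rightarrow> 'm"
  where "partial_deriv \<D> C A f = \<langle>\<one> C \<boxtimes> \<pi>\<^sub>0 A A, \<zero> C C \<boxtimes> \<pi>\<^sub>1 A A\<rangle> \<cdot> \<D> f"

locale cartesian_closed_differential_category =
  cartesian_closed_left_additive_category X + differential_combinator X \<D>
  for X :: "('o, 'm, 'x) closed_data_scheme" (structure) and \<D> :: "'m \<Rightarrow> 'm" +
  assumes CD_Curry: "C \<in> Obj X \<Longrightarrow> A \<in> Obj X \<Longrightarrow> f \<in> hom X (C \<otimes> A) B
          \<Longrightarrow> \<D> (\<Lambda> C A f) = \<Lambda> C (A \<otimes> A) (partial_deriv \<D> C A f)"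

section \<open>Linearizing combinators\<close>

locale linearizing_combinator = cartesian_left_additive_category X
  for X :: "('o, 'm, 'x) cartesian_data_scheme" (structure) +
  fixes L :: "'m \<Rightarrow> 'm"
  assumes L_hom: "f \<in> hom X A B \<Longrightarrow> L f \<in> hom X A B"
    and L1_Add: "f \<in> hom X A B \<Longrightarrow> g \<in> hom X A B \<Longrightarrow> L (f \<oplus> g) = L f \<oplus> L g"
    and L1_Zero: "A \<in> Obj X \<Longrightarrow> B \<in> Obj X \<Longrightarrow> L (\<zero> A B) = \<zero> A B"
    and L2: "f \<in> hom X A B \<Longrightarrow> additive (L f)"
    and L3_Ident: "A \<in> Obj X \<Longrightarrow> L (\<one> A) = \<one> A"
    and L3_Proj0: "A \<in> Obj X \<Longrightarrow> B \<in> Obj X \<Longrightarrow> L (\<pi>\<^sub>0 A B) = \<pi>\<^sub>0 A B"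
    and L3_Proj1: "A \<in> Obj X \<Longrightarrow> B \<in> Obj X \<Longrightarrow> L (\<pi>\<^sub>1 A B) = \<pi>\<^sub>1 A B"
    and L4: "f \<in> hom X Z A \<Longrightarrow> g \<in> hom X Z B \<Longrightarrow> L \<langle>f, g\<rangle> = \<langle>L f, L g\<rangle>"
    and L5: "f \<in> hom X A B \<Longrightarrow> g \<in> hom X B C
          \<Longrightarrow> L (f \<cdot> g) = L f \<cdot> L ((\<one> B \<oplus> \<zero> B A \<cdot> f) \<cdot> g)"
    and L6: "f \<in> hom X A B \<Longrightarrow> L (L f) = L f"

(* for f : A \<otimes> B \<rightarrow> C *)
definition (in cartesian_closed_left_additive_category) lin0 ::
    "('m \<Rightarrow> 'm) \<Rightarrow> 'o \<Rightarrow> 'o \<Rightarrow> 'm \<Rightarrow> 'm"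
  where "lin0 L A B f = twist A B \<cdot> uncurry B (Cod X f) (L (\<Lambda> B A (twist B A \<cdot> f)))"

definition (in cartesian_closed_left_additive_category) lin1 ::
    "('m \<Rightarrow> 'm) \<Rightarrow> 'o \<Rightarrow> 'o \<Rightarrow> 'm \<Rightarrow> 'm"
  where "lin1 L A B f = uncurry A (Cod X f) (L (\<Lambda> A B f))"

locale exponentiable_linearizing_combinator =
  cartesian_closed_left_additive_category X + linearizing_combinator X L
  for X :: "('o, 'm, 'x) closed_data_scheme" (structure) and L :: "'m \<Rightarrow> 'm" +
  assumes EL1_unit: "C \<in> Obj X \<Longrightarrow> A \<in> Obj X \<Longrightarrow> L (exp_unit C A) = exp_unit C A"
    and EL1_mult: "C \<in> Obj X \<Longrightarrow> A \<in> Obj X \<Longrightarrow> L (exp_mult C A) = exp_mult C A"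
    and EL2: "f \<in> hom X C D \<Longrightarrow> g \<in> hom X A B \<Longrightarrow> L (exp_map f g) = exp_map f (L g)"
    and EL3: "A \<in> Obj X \<Longrightarrow> B \<in> Obj X \<Longrightarrow> f \<in> hom X (A \<otimes> B) C
          \<Longrightarrow> lin0 L A B (lin1 L A B f) = lin1 L A B (lin0 L A B f)"

section \<open>Systems of linearizing combinators\<close>

context cartesian_left_additive_category
begin

definition assoc_map :: "'o \<Rightarrow> 'o \<Rightarrow> 'o \<Rightarrow> 'm"
  where "assoc_map C A B = \<langle>\<one> C \<boxtimes> \<pi>\<^sub>0 A B, \<pi>\<^sub>1 C (A \<otimes> B) \<cdot> \<pi>\<^sub>1 A B\<rangle>"

definition assoc_swap :: "'o \<Rightarrow> 'o \<Rightarrow> 'o \<Rightarrow> 'm"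
  where "assoc_swap C A B = \<langle>\<one> C \<boxtimes> \<pi>\<^sub>1 A B, \<pi>\<^sub>1 C (A \<otimes> B) \<cdot> \<pi>\<^sub>0 A B\<rangle>"

(* In LS C A f the arrow f has domain C \<otimes> A. In the next two, f : C \<otimes> (A \<otimes> B) \<rightarrow> D. *)
definition sys_lin0 :: "('o \<Rightarrow> 'o \<Rightarrow> 'm \<Rightarrow> 'm) \<Rightarrow> 'o \<Rightarrow> 'o \<Rightarrow> 'o \<Rightarrow> 'm \<Rightarrow> 'm"
  where "sys_lin0 LS C A B f =
    assoc_swap C A B \<cdot> LS (C \<otimes> B) A (iso_inv (assoc_swap C A B) \<cdot> f)"

definition sys_lin1 :: "('o \<Rightarrow> 'o \<Rightarrow> 'm \<Rightarrow> 'm) \<Rightarrow> 'o \<Rightarrow> 'o \<Rightarrow> 'o \<Rightarrow> 'm \<Rightarrow> 'm"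
  where "sys_lin1 LS C A B f =
    assoc_map C A B \<cdot> LS (C \<otimes> A) B (iso_inv (assoc_map C A B) \<cdot> f)"

definition sys_linearizing :: "('o \<Rightarrow> 'o \<Rightarrow> 'm \<Rightarrow> 'm) \<Rightarrow> 'm \<Rightarrow> 'm"
  where "sys_linearizing LS f =
    \<langle>\<zero> (Dom X f) \<top>, \<one> (Dom X f)\<rangle> \<cdot> LS \<top> (Dom X f) (\<pi>\<^sub>1 \<top> (Dom X f) \<cdot> f)"

definition sys_differential :: "('o \<Rightarrow> 'o \<Rightarrow> 'm \<Rightarrow> 'm) \<Rightarrow> 'm \<Rightarrow> 'm"
  where "sys_differential LS f = LS (Dom X f) (Dom X f) (sum_map (Dom X f) \<cdot> f)"

end

locale linearizing_system = cartesian_left_additive_category X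
  for X :: "('o, 'm, 'x) cartesian_data_scheme" (structure) +
  fixes LS :: "'o \<Rightarrow> 'o \<Rightarrow> 'm \<Rightarrow> 'm"
  assumes LS_hom: "C \<in> Obj X \<Longrightarrow> A \<in> Obj X \<Longrightarrow> f \<in> hom X (C \<otimes> A) B
          \<Longrightarrow> LS C A f \<in> hom X (C \<otimes> A) B"
    and LS1_Add: "C \<in> Obj X \<Longrightarrow> A \<in> Obj X \<Longrightarrow> f \<in> hom X (C \<otimes> A) B \<Longrightarrow> g \<in> hom X (C \<otimes> A) B
          \<Longrightarrow> LS C A (f \<oplus> g) = LS C A f \<oplus> LS C A g"
    and LS1_Zero: "C \<in> Obj X \<Longrightarrow> A \<in> Obj X \<Longrightarrow> B \<in> Obj X
          \<Longrightarrow> LS C A (\<zero> (C \<otimes> A) B) = \<zero> (C \<otimes> A) B"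
    and LS2_Add: "C \<in> Obj X \<Longrightarrow> A \<in> Obj X \<Longrightarrow> f \<in> hom X (C \<otimes> A) B
          \<Longrightarrow> (\<one> C \<boxtimes> sum_map A) \<cdot> LS C A f
              = (\<one> C \<boxtimes> \<pi>\<^sub>0 A A) \<cdot> LS C A f \<oplus> (\<one> C \<boxtimes> \<pi>\<^sub>1 A A) \<cdot> LS C A f"
    and LS2_Zero: "C \<in> Obj X \<Longrightarrow> A \<in> Obj X \<Longrightarrow> f \<in> hom X (C \<otimes> A) B
          \<Longrightarrow> \<langle>\<pi>\<^sub>0 C A, \<zero> (C \<otimes> A) A\<rangle> \<cdot> LS C A f = \<zero> (C \<otimes> A) B"
    and LS3_Proj1: "C \<in> Obj X \<Longrightarrow> A \<in> Obj X \<Longrightarrow> LS C A (\<pi>\<^sub>1 C A) = \<pi>\<^sub>1 C A"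
    and LS3_Proj1_Proj0: "C \<in> Obj X \<Longrightarrow> A \<in> Obj X \<Longrightarrow> B \<in> Obj X
          \<Longrightarrow> LS C (A \<otimes> B) (\<pi>\<^sub>1 C (A \<otimes> B) \<cdot> \<pi>\<^sub>0 A B) = \<pi>\<^sub>1 C (A \<otimes> B) \<cdot> \<pi>\<^sub>0 A B"
    and LS3_Proj1_Proj1: "C \<in> Obj X \<Longrightarrow> A \<in> Obj X \<Longrightarrow> B \<in> Obj X
          \<Longrightarrow> LS C (A \<otimes> B) (\<pi>\<^sub>1 C (A \<otimes> B) \<cdot> \<pi>\<^sub>1 A B) = \<pi>\<^sub>1 C (A \<otimes> B) \<cdot> \<pi>\<^sub>1 A B"
    and LS4: "C \<in> Obj X \<Longrightarrow> A \<in> Obj X \<Longrightarrow> f \<in> hom X (C \<otimes> A) B \<Longrightarrow> g \<in> hom X (C \<otimes> A) D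
          \<Longrightarrow> LS C A \<langle>f, g\<rangle> = \<langle>LS C A f, LS C A g\<rangle>"
    and LS5: "C \<in> Obj X \<Longrightarrow> A \<in> Obj X \<Longrightarrow> B \<in> Obj X
          \<Longrightarrow> f \<in> hom X (C \<otimes> A) B \<Longrightarrow> g \<in> hom X (C \<otimes> B) D
          \<Longrightarrow> LS C A (\<langle>\<pi>\<^sub>0 C A, f\<rangle> \<cdot> g)
              = \<langle>\<pi>\<^sub>0 C A, LS C A f\<rangle> \<cdot>
                LS C B (\<langle>\<pi>\<^sub>0 C B, \<pi>\<^sub>1 C B \<oplus> \<langle>\<pi>\<^sub>0 C B, \<zero> (C \<otimes> B) A\<rangle> \<cdot> f\<rangle> \<cdot> g)"
    and LS6: "C \<in> Obj X \<Longrightarrow> A \<in> Obj X \<Longrightarrow> f \<in> hom X (C \<otimes> A) B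
          \<Longrightarrow> LS C A (LS C A f) = LS C A f"
    and LS7: "C \<in> Obj X \<Longrightarrow> A \<in> Obj X \<Longrightarrow> B \<in> Obj X \<Longrightarrow> f \<in> hom X (C \<otimes> (A \<otimes> B)) D
          \<Longrightarrow> sys_lin1 LS C A B (sys_lin0 LS C A B f) = sys_lin0 LS C A B (sys_lin1 LS C A B f)"
    and LS8: "h \<in> hom X C' C \<Longrightarrow> A \<in> Obj X \<Longrightarrow> f \<in> hom X (C \<otimes> A) B
          \<Longrightarrow> (h \<boxtimes> \<one> A) \<cdot> LS C A f = LS C' A ((h \<boxtimes> \<one> A) \<cdot> f)"

locale closed_linearizing_system =
  cartesian_closed_left_additive_category X + linearizing_system X LS
  for X :: "('o, 'm, 'x) closed_data_scheme" (structure) and LS :: "'o \<Rightarrow> 'o \<Rightarrow> 'm \<Rightarrow> 'm" +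
  assumes LS_Curry: "C \<in> Obj X \<Longrightarrow> A \<in> Obj X \<Longrightarrow> f \<in> hom X (C \<otimes> A) B
          \<Longrightarrow> \<langle>\<zero> A \<top>, \<one> A\<rangle> \<cdot> LS \<top> A (\<pi>\<^sub>1 \<top> A \<cdot> \<Lambda> C A f) = \<Lambda> C A (LS C A f)"

section \<open>The system and the differential combinator of an exponentiable linearizing combinator\<close>

context cartesian_closed_left_additive_category
begin

definition lin_system :: "('m \<Rightarrow> 'm) \<Rightarrow> 'o \<Rightarrow> 'o \<Rightarrow> 'm \<Rightarrow> 'm"
  where "lin_system L C A f = uncurry C (Cod X f) (L (\<Lambda> C A f))"

definition lin_differential :: "('m \<Rightarrow> 'm) \<Rightarrow> 'm \<Rightarrow> 'm"
  where "lin_differential L f =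
    uncurry (Dom X f) (Cod X f) (L (\<Lambda> (Dom X f) (Dom X f) (sum_map (Dom X f) \<cdot> f)))"

end

end

theory Submission
  imports Defs
begin

text \<open>
  The operator \<open>L\<close> takes the linear part at \<open>0\<close> of a map, and closedness allows it to be applied in one
  argument while the others are parameters: \<open>\<Lambda> C A f\<close> turns \<open>f : C \<otimes> A \<rightarrow> B\<close> into a map out of \<open>A\<close>
  alone, and \<open>LS C A f\<close> is the uncurried linear part of that map. The derivative of \<open>f\<close> at \<open>a\<close> in
  direction \<open>b\<close> is then the linear part, at \<open>x = b\<close>, of \<open>x \<mapsto> f (a + x)\<close>. The comments below
  use such elements informally; for example, \<open>LS C A f\<close> is the linearization of \<open>f (c, x)\<close> in \<open>x\<close>.

  Why \<open>LS\<close> is a closed system. Call \<open>g\<close> linear if \<open>L g = g\<close>. Postcomposition with a linear map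
  commutes with \<open>L\<close> (\<open>L_postcompose_linear\<close>), because the correction term in the chain rule for
  \<open>L\<close> is the linear part of a constant, which is \<open>0\<close>. The axioms on the exponential say
  that unit, multiplication and the functorial action \<open>[h, g]\<close> with linear \<open>g\<close> are linear. Hence
  every operation on curried maps that is assembled from these commutes with linearization, and
  the axioms of a system on projections, reindexing and composition follow: discarding the
  parameter is the unit, reindexing it is \<open>[h, 1]\<close>, and composing in a fixed context is Kleisli
  composition for the monad \<open>[C, _]\<close> (\<open>Curry_Kleisli\<close>). Joining two parameters into
  one is the map \<open>[A, [C, D]] \<rightarrow> [C \<otimes> A, D]\<close>, which is \<open>[\<pi>1, [\<pi>0, 1]]\<close> followed by the
  multiplication and therefore linear (\<open>Curry_Curry_exp_prod\<close>, \<open>L_exp_prod\<close>). It follows that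
  the two partial linearizations of the system are curried into those of \<open>L\<close>
  (\<open>Curry_sys_lin1\<close>, \<open>Curry_sys_lin0\<close>), so that they commute because the latter do.

  Why a system yields a differential combinator. This holds in every Cartesian left additive category. The chain
  rule and the reduction of \<open>D (D f)\<close> along the lift map are short calculations with the chain rule and reindexing
  for systems. For the symmetry of second derivatives, additivity in the linear argument
  splits the second derivative (\<open>deriv_deriv_eq\<close>) as
  \<open>D (D f) ((a, b), (a', b')) = M (a, b, a') + D f (a, b')\<close>,
  where \<open>M\<close> linearizes \<open>f (a + x + y)\<close> in \<open>y\<close> at \<open>b\<close> and in \<open>x\<close> at \<open>a'\<close>. The commutation of
  partial linearizations says precisely that \<open>M\<close> is symmetric in \<open>b\<close> and \<open>a'\<close>
  (\<open>LS_shifted_deriv_symmetric\<close>), and the interchange map swaps just these two.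

  Finally, the partial derivative of \<open>f\<close> in its second argument is a partial linearization of
  \<open>f (c, a + x)\<close> (\<open>partial_deriv_eq_sys_lin1\<close>), so the compatibility of the derivative with currying
  is again \<open>Curry_sys_lin1\<close>.
\<close>

section \<open>Typed composition, sums and pairs\<close>

text \<open>
  The rewrite rules of this section and the next state typing by \<open>Arr\<close>, \<open>Dom\<close> and \<open>Cod\<close>, since
  a premise \<open>f \<in> hom X A B\<close> would leave objects for the simplifier to guess. Composites are
  associated to the right and precomposition is pushed inside pairs, sums and curried maps. Hence
  most cut rules come in two forms, the second one with a further map composed at the end.
\<close>

context category
begin

lemma in_hom [simp]: "f \<in> hom X A B \<longleftrightarrow> f \<in> Arr X \<and> Dom X f = A \<and> Cod X f = B"
  by (simp add: hom_def)

declare Dom_Obj [simp] Cod_Obj [simp]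

lemma Ident_type [simp]:
  assumes "A \<in> Obj X"
  shows "\<one> A \<in> Arr X" "Dom X (\<one> A) = A" "Cod X (\<one> A) = A"
  using Ident_hom [OF assms] by simp_all

lemma Comp_type [simp]:
  assumes "f \<in> Arr X" "g \<in> Arr X" "Cod X f = Dom X g"
  shows "f \<cdot> g \<in> Arr X" "Dom X (f \<cdot> g) = Dom X f" "Cod X (f \<cdot> g) = Cod X g"
  using Comp_hom [of f "Dom X f" "Cod X f" g "Cod X g"] assms by simp_all

lemma Ident_Comp [simp]: "f \<in> Arr X \<Longrightarrow> Dom X f = A \<Longrightarrow> \<one> A \<cdot> f = f"
  using Ident_left [of f A "Cod X f"] by simp

lemma Comp_Ident [simp]: "f \<in> Arr X \<Longrightarrow> Cod X f = B \<Longrightarrow> f \<cdot> \<one> B = f"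
  using Ident_right [of f "Dom X f" B] by simp

lemma Comp_Comp [simp]:
  assumes "f \<in> Arr X" "g \<in> Arr X" "h \<in> Arr X" "Cod X f = Dom X g" "Cod X g = Dom X h"
  shows "(f \<cdot> g) \<cdot> h = f \<cdot> (g \<cdot> h)"
  using Comp_assoc [of f "Dom X f" "Cod X f" g "Cod X g" h "Cod X h"] assms by simp

lemma iso_inv_eqI:
  assumes "f \<in> hom X A B" "g \<in> hom X B A" "f \<cdot> g = \<one> A" "g \<cdot> f = \<one> B"
  shows "iso_inv f = g"
proof -
  have "h = g" if "h \<in> hom X B A" "f \<cdot> h = \<one> A" for h
  proof -
    have "h = (g \<cdot> f) \<cdot> h" using assms that by auto
    also have "\<dots> = g \<cdot> (f \<cdot> h)" using assms(1,2) that(1) by (intro Comp_assoc)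
    also have "\<dots> = g" using assms that by auto
    finally show ?thesis .
  qed
  moreover have "Dom X f = A" "Cod X f = B" using assms by simp_all
  ultimately show ?thesis
    unfolding iso_inv_def using assms(2-4) by (intro the_equality) blast+
qed

end

context left_additive_category
begin

lemma Zero_type [simp]:
  assumes "A \<in> Obj X" "B \<in> Obj X"
  shows "\<zero> A B \<in> Arr X" "Dom X (\<zero> A B) = A" "Cod X (\<zero> A B) = B"
  using Zero_hom [OF assms] by simp_all

lemma Add_type [simp]:
  assumes "f \<in> Arr X" "g \<in> Arr X" "Dom X f = Dom X g" "Cod X f = Cod X g"
  shows "f \<oplus> g \<in> Arr X" "Dom X (f \<oplus> g) = Dom X g" "Cod X (f \<oplus> g) = Cod X g"
  using Add_hom [of f "Dom X f" "Cod X f" g] assms by simp_all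

lemma Add_Zero_right [simp]:
  "f \<in> Arr X \<Longrightarrow> Dom X f = A \<Longrightarrow> Cod X f = B \<Longrightarrow> f \<oplus> \<zero> A B = f"
  by (rule Add_Zero) simp

lemma Add_Zero_left [simp]:
  "f \<in> Arr X \<Longrightarrow> Dom X f = A \<Longrightarrow> Cod X f = B \<Longrightarrow> \<zero> A B \<oplus> f = f"
  using Add_commute [of "\<zero> A B" A B f] by auto

lemma Comp_Add_distrib [simp]:
  assumes "f \<in> Arr X" "g \<in> Arr X" "h \<in> Arr X"
    "Cod X f = Dom X g" "Dom X g = Dom X h" "Cod X g = Cod X h"
  shows "f \<cdot> (g \<oplus> h) = f \<cdot> g \<oplus> f \<cdot> h"
  using Comp_Add [of f "Dom X f" "Dom X g" g "Cod X g" h] assms by simp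

lemma Comp_Add_Comp [simp]:
  assumes "f \<in> Arr X" "g \<in> Arr X" "h \<in> Arr X" "k \<in> Arr X"
    "Cod X f = Dom X g" "Dom X g = Dom X h" "Cod X g = Cod X h" "Dom X k = Cod X h"
  shows "f \<cdot> ((g \<oplus> h) \<cdot> k) = (f \<cdot> g \<oplus> f \<cdot> h) \<cdot> k"
  using assms by (subst Comp_Comp [symmetric]) simp_all

lemma Comp_Zero_absorb [simp]:
  "f \<in> Arr X \<Longrightarrow> Cod X f = B \<Longrightarrow> C \<in> Obj X \<Longrightarrow> f \<cdot> \<zero> B C = \<zero> (Dom X f) C"
  by (rule Comp_Zero) simp_all

lemma additive_Zero:
  "additive f \<Longrightarrow> Dom X f = A \<Longrightarrow> Z \<in> Obj X \<Longrightarrow> \<zero> Z A \<cdot> f = \<zero> Z (Cod X f)"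
  by (auto simp: additive_def)

lemma additive_Add:
  assumes "additive f" "g \<in> Arr X" "h \<in> Arr X" "Cod X g = Dom X f" "Cod X h = Dom X f"
    "Dom X g = Dom X h"
  shows "(g \<oplus> h) \<cdot> f = g \<cdot> f \<oplus> h \<cdot> f"
proof -
  have "g \<in> hom X (Dom X g) (Dom X f)" "h \<in> hom X (Dom X g) (Dom X f)" "Dom X g \<in> Obj X"
    using assms by simp_all
  then show ?thesis using assms(1) by (simp only: additive_def)
qed

lemma Add_assoc_right:
  assumes "f \<in> Arr X" "g \<in> Arr X" "h \<in> Arr X" "Dom X f = Dom X g" "Dom X g = Dom X h"
    "Cod X f = Cod X g" "Cod X g = Cod X h"
  shows "(f \<oplus> g) \<oplus> h = f \<oplus> (g \<oplus> h)"
  using Add_assoc [of f "Dom X h" "Cod X h" g h] assms by simp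

lemma Add_swap:
  "f \<in> Arr X \<Longrightarrow> g \<in> Arr X \<Longrightarrow> Dom X f = Dom X g \<Longrightarrow> Cod X f = Cod X g \<Longrightarrow> f \<oplus> g = g \<oplus> f"
  by (rule Add_commute) simp_all

lemma Add_left_swap:
  assumes "f \<in> Arr X" "g \<in> Arr X" "h \<in> Arr X" "Dom X f = Dom X g" "Dom X g = Dom X h"
    "Cod X f = Cod X g" "Cod X g = Cod X h"
  shows "f \<oplus> (g \<oplus> h) = g \<oplus> (f \<oplus> h)"
proof -
  have "f \<oplus> (g \<oplus> h) = (g \<oplus> f) \<oplus> h"
    using assms Add_swap [of f g] by (simp add: Add_assoc_right [symmetric])
  then show ?thesis using assms by (simp add: Add_assoc_right)
qed

lemmas Add_ac = Add_assoc_right Add_swap Add_left_swap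

end

context cartesian_left_additive_category
begin

declare Prod_Obj [simp] Top_Obj [simp]

lemma Proj_type [simp]:
  assumes "A \<in> Obj X" "B \<in> Obj X"
  shows "\<pi>\<^sub>0 A B \<in> Arr X" "Dom X (\<pi>\<^sub>0 A B) = A \<otimes> B" "Cod X (\<pi>\<^sub>0 A B) = A"
    "\<pi>\<^sub>1 A B \<in> Arr X" "Dom X (\<pi>\<^sub>1 A B) = A \<otimes> B" "Cod X (\<pi>\<^sub>1 A B) = B"
  using Proj0_hom [OF assms] Proj1_hom [OF assms] by simp_all

lemma Pair_type [simp]:
  assumes "f \<in> Arr X" "g \<in> Arr X" "Dom X f = Dom X g"
  shows "\<langle>f, g\<rangle> \<in> Arr X" "Dom X \<langle>f, g\<rangle> = Dom X g" "Cod X \<langle>f, g\<rangle> = Cod X f \<otimes> Cod X g"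
  using Pair_hom [of f "Dom X f" "Cod X f" g "Cod X g"] assms by simp_all

lemma Pair_Comp_Proj [simp]:
  assumes "f \<in> Arr X" "g \<in> Arr X" "Dom X f = Dom X g" "Cod X f = A" "Cod X g = B"
  shows "\<langle>f, g\<rangle> \<cdot> \<pi>\<^sub>0 A B = f" "\<langle>f, g\<rangle> \<cdot> \<pi>\<^sub>1 A B = g"
  using Pair_Proj0 [of f "Dom X f" A g B] Pair_Proj1 [of f "Dom X f" A g B] assms by simp_all

lemma Pair_Comp_Proj_Comp [simp]:
  assumes "f \<in> Arr X" "g \<in> Arr X" "Dom X f = Dom X g" "Cod X f = A" "Cod X g = B" "h \<in> Arr X"
  shows "Dom X h = A \<Longrightarrow> \<langle>f, g\<rangle> \<cdot> (\<pi>\<^sub>0 A B \<cdot> h) = f \<cdot> h"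
    "Dom X h = B \<Longrightarrow> \<langle>f, g\<rangle> \<cdot> (\<pi>\<^sub>1 A B \<cdot> h) = g \<cdot> h"
proof -
  have Ob: "A \<in> Obj X" "B \<in> Obj X" using assms by auto
  show "\<langle>f, g\<rangle> \<cdot> (\<pi>\<^sub>0 A B \<cdot> h) = f \<cdot> h" if "Dom X h = A"
    using assms that Ob by (subst Comp_Comp [symmetric]) simp_all
  show "\<langle>f, g\<rangle> \<cdot> (\<pi>\<^sub>1 A B \<cdot> h) = g \<cdot> h" if "Dom X h = B"
    using assms that Ob by (subst Comp_Comp [symmetric]) simp_all
qed

lemma Pair_eqI:
  assumes "A \<in> Obj X" "B \<in> Obj X" "h \<in> hom X Z (A \<otimes> B)" "k \<in> hom X Z (A \<otimes> B)"
    "h \<cdot> \<pi>\<^sub>0 A B = k \<cdot> \<pi>\<^sub>0 A B" "h \<cdot> \<pi>\<^sub>1 A B = k \<cdot> \<pi>\<^sub>1 A B"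
  shows "h = k"
proof -
  have "h = \<langle>h \<cdot> \<pi>\<^sub>0 A B, h \<cdot> \<pi>\<^sub>1 A B\<rangle>"
    by (rule Pair_unique [symmetric]) fact+
  also have "\<dots> = \<langle>k \<cdot> \<pi>\<^sub>0 A B, k \<cdot> \<pi>\<^sub>1 A B\<rangle>" by (simp only: assms(5,6))
  also have "\<dots> = k" by (rule Pair_unique) fact+
  finally show ?thesis .
qed

lemma Comp_Pair [simp]:
  assumes "f \<in> Arr X" "g \<in> Arr X" "h \<in> Arr X" "Cod X f = Dom X g" "Dom X g = Dom X h"
  shows "f \<cdot> \<langle>g, h\<rangle> = \<langle>f \<cdot> g, f \<cdot> h\<rangle>"
  by (rule Pair_eqI [of "Cod X g" "Cod X h" _ "Dom X f"]) (use assms in simp_all)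

lemma Comp_Pair_Comp [simp]:
  assumes "f \<in> Arr X" "g \<in> Arr X" "h \<in> Arr X" "Cod X f = Dom X g" "Dom X g = Dom X h"
    "k \<in> Arr X" "Dom X k = Cod X g \<otimes> Cod X h"
  shows "f \<cdot> (\<langle>g, h\<rangle> \<cdot> k) = \<langle>f \<cdot> g, f \<cdot> h\<rangle> \<cdot> k"
  using assms by (subst Comp_Comp [symmetric]) simp_all

lemma Pair_Proj [simp]: "A \<in> Obj X \<Longrightarrow> B \<in> Obj X \<Longrightarrow> \<langle>\<pi>\<^sub>0 A B, \<pi>\<^sub>1 A B\<rangle> = \<one> (A \<otimes> B)"
  by (rule Pair_eqI [of A B _ "A \<otimes> B"]) simp_all

lemma Pair_Comp_Projs [simp]:
  "A \<in> Obj X \<Longrightarrow> B \<in> Obj X \<Longrightarrow> h \<in> Arr X \<Longrightarrow> Cod X h = A \<otimes> B \<Longrightarrow> \<langle>h \<cdot> \<pi>\<^sub>0 A B, h \<cdot> \<pi>\<^sub>1 A B\<rangle> = h"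
  by (rule Pair_unique) simp_all

lemma Add_Comp_Proj [simp]:
  assumes "f \<in> Arr X" "g \<in> Arr X" "Dom X f = Dom X g" "Cod X f = A \<otimes> B" "Cod X g = A \<otimes> B"
    "A \<in> Obj X" "B \<in> Obj X"
  shows "(f \<oplus> g) \<cdot> \<pi>\<^sub>0 A B = f \<cdot> \<pi>\<^sub>0 A B \<oplus> g \<cdot> \<pi>\<^sub>0 A B"
    "(f \<oplus> g) \<cdot> \<pi>\<^sub>1 A B = f \<cdot> \<pi>\<^sub>1 A B \<oplus> g \<cdot> \<pi>\<^sub>1 A B"
  using assms by (simp_all add: additive_Add Proj0_additive Proj1_additive)

lemma Zero_Comp_Proj [simp]:
  assumes "Z \<in> Obj X" "A \<in> Obj X" "B \<in> Obj X"
  shows "\<zero> Z (A \<otimes> B) \<cdot> \<pi>\<^sub>0 A B = \<zero> Z A" "\<zero> Z (A \<otimes> B) \<cdot> \<pi>\<^sub>1 A B = \<zero> Z B"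
  using assms by (simp_all add: additive_Zero Proj0_additive Proj1_additive)

lemma Pair_Add [simp]:
  assumes "f \<in> Arr X" "g \<in> Arr X" "h \<in> Arr X" "k \<in> Arr X" "Dom X f = Dom X k"
    "Dom X g = Dom X k" "Dom X h = Dom X k" "Cod X f = Cod X h" "Cod X g = Cod X k"
  shows "\<langle>f, g\<rangle> \<oplus> \<langle>h, k\<rangle> = \<langle>f \<oplus> h, g \<oplus> k\<rangle>"
  by (rule Pair_eqI [of "Cod X h" "Cod X k" _ "Dom X k"]) (use assms in simp_all)

lemma Pair_Zero [simp]:
  assumes "Z \<in> Obj X" "A \<in> Obj X" "B \<in> Obj X"
  shows "\<langle>\<zero> Z A, \<zero> Z B\<rangle> = \<zero> Z (A \<otimes> B)"
  by (rule Pair_eqI [of A B _ Z]) (use assms in simp_all)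

lemma prod_map_eq [simp]:
  "Dom X f = A \<Longrightarrow> Dom X g = B \<Longrightarrow> f \<boxtimes> g = \<langle>\<pi>\<^sub>0 A B \<cdot> f, \<pi>\<^sub>1 A B \<cdot> g\<rangle>"
  by (simp add: prod_map_def)

lemma iso_inv_assoc_map:
  assumes "C \<in> Obj X" "A \<in> Obj X" "B \<in> Obj X"
  shows "iso_inv (assoc_map C A B) =
    \<langle>\<pi>\<^sub>0 (C \<otimes> A) B \<cdot> \<pi>\<^sub>0 C A, \<langle>\<pi>\<^sub>0 (C \<otimes> A) B \<cdot> \<pi>\<^sub>1 C A, \<pi>\<^sub>1 (C \<otimes> A) B\<rangle>\<rangle>"
  by (rule iso_inv_eqI [of _ "C \<otimes> (A \<otimes> B)" "(C \<otimes> A) \<otimes> B"])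
    (use assms in \<open>simp_all add: assoc_map_def\<close>)

lemma iso_inv_assoc_swap:
  assumes "C \<in> Obj X" "A \<in> Obj X" "B \<in> Obj X"
  shows "iso_inv (assoc_swap C A B) =
    \<langle>\<pi>\<^sub>0 (C \<otimes> B) A \<cdot> \<pi>\<^sub>0 C B, \<langle>\<pi>\<^sub>1 (C \<otimes> B) A, \<pi>\<^sub>0 (C \<otimes> B) A \<cdot> \<pi>\<^sub>1 C B\<rangle>\<rangle>"
  by (rule iso_inv_eqI [of _ "C \<otimes> (A \<otimes> B)" "(C \<otimes> B) \<otimes> A"])
    (use assms in \<open>simp_all add: assoc_swap_def\<close>)

lemma sys_lin0_eq:
  assumes "C \<in> Obj X" "A \<in> Obj X" "B \<in> Obj X"
  shows "sys_lin0 LS C A B f =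
    \<langle>\<langle>\<pi>\<^sub>0 C (A \<otimes> B), \<pi>\<^sub>1 C (A \<otimes> B) \<cdot> \<pi>\<^sub>1 A B\<rangle>, \<pi>\<^sub>1 C (A \<otimes> B) \<cdot> \<pi>\<^sub>0 A B\<rangle> \<cdot>
    LS (C \<otimes> B) A
      (\<langle>\<pi>\<^sub>0 (C \<otimes> B) A \<cdot> \<pi>\<^sub>0 C B, \<langle>\<pi>\<^sub>1 (C \<otimes> B) A, \<pi>\<^sub>0 (C \<otimes> B) A \<cdot> \<pi>\<^sub>1 C B\<rangle>\<rangle> \<cdot> f)"
  unfolding sys_lin0_def iso_inv_assoc_swap [OF assms] using assms by (simp add: assoc_swap_def)

lemma sys_lin1_eq:
  assumes "C \<in> Obj X" "A \<in> Obj X" "B \<in> Obj X"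
  shows "sys_lin1 LS C A B f =
    \<langle>\<langle>\<pi>\<^sub>0 C (A \<otimes> B), \<pi>\<^sub>1 C (A \<otimes> B) \<cdot> \<pi>\<^sub>0 A B\<rangle>, \<pi>\<^sub>1 C (A \<otimes> B) \<cdot> \<pi>\<^sub>1 A B\<rangle> \<cdot>
    LS (C \<otimes> A) B
      (\<langle>\<pi>\<^sub>0 (C \<otimes> A) B \<cdot> \<pi>\<^sub>0 C A, \<langle>\<pi>\<^sub>0 (C \<otimes> A) B \<cdot> \<pi>\<^sub>1 C A, \<pi>\<^sub>1 (C \<otimes> A) B\<rangle>\<rangle> \<cdot> f)"
  unfolding sys_lin1_def iso_inv_assoc_map [OF assms] using assms by (simp add: assoc_map_def)

end

section \<open>Currying and the exponential monad\<close>

context cartesian_closed_left_additive_category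
begin

declare Exp_Obj [simp]

lemma Eval_type [simp]:
  assumes "C \<in> Obj X" "A \<in> Obj X"
  shows "\<epsilon> C A \<in> Arr X" "Dom X (\<epsilon> C A) = C \<otimes> \<^bold>[C, A\<^bold>]" "Cod X (\<epsilon> C A) = A"
  using Eval_hom [OF assms] by simp_all

lemma Curry_type [simp]:
  assumes "C \<in> Obj X" "A \<in> Obj X" "f \<in> Arr X" "Dom X f = C \<otimes> A"
  shows "\<Lambda> C A f \<in> Arr X" "Dom X (\<Lambda> C A f) = A" "Cod X (\<Lambda> C A f) = \<^bold>[C, Cod X f\<^bold>]"
  using Curry_hom [of C A f "Cod X f"] assms by simp_all

lemma uncurry_type [simp]:
  assumes "C \<in> Obj X" "B \<in> Obj X" "g \<in> Arr X" "Cod X g = \<^bold>[C, B\<^bold>]"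
  shows "uncurry C B g \<in> Arr X" "Dom X (uncurry C B g) = C \<otimes> Dom X g" "Cod X (uncurry C B g) = B"
  using assms by (simp_all add: uncurry_def)

lemma uncurry_Curry [simp]:
  assumes "C \<in> Obj X" "A \<in> Obj X" "f \<in> Arr X" "Dom X f = C \<otimes> A" "Cod X f = B"
  shows "uncurry C B (\<Lambda> C A f) = f"
  unfolding uncurry_def using assms by (intro Curry_Eval) simp_all

lemma Curry_uncurry [simp]:
  assumes "C \<in> Obj X" "B \<in> Obj X" "g \<in> Arr X" "Dom X g = A" "Cod X g = \<^bold>[C, B\<^bold>]"
  shows "\<Lambda> C A (uncurry C B g) = g"
proof -
  have "A \<in> Obj X" using assms by auto
  with assms have "uncurry C B g \<in> hom X (C \<otimes> A) B" "g \<in> hom X A \<^bold>[C, B\<^bold>]" by simp_all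
  then show ?thesis
    using assms by (intro Curry_unique [symmetric, of C B _ A]) (simp_all only: uncurry_def)
qed

text \<open>
  The beta rule, with the substitution \<open>u\<close> for the parameter carried along, so that
  evaluation of a curried map can be rewritten wherever it occurs.
\<close>

lemma Pair_Curry_Eval [simp]:
  assumes "C \<in> Obj X" "A \<in> Obj X" "u \<in> Arr X" "f \<in> Arr X" "Dom X f = C \<otimes> A" "Cod X f = B"
    "Dom X u = A" "Cod X u = C"
  shows "\<langle>u, \<Lambda> C A f\<rangle> \<cdot> \<epsilon> C B = \<langle>u, \<one> A\<rangle> \<cdot> f"
proof -
  have [simp]: "B \<in> Obj X" using assms by auto
  have "\<langle>u, \<Lambda> C A f\<rangle> \<cdot> \<epsilon> C B = \<langle>u, \<one> A\<rangle> \<cdot> ((\<one> C \<boxtimes> \<Lambda> C A f) \<cdot> \<epsilon> C B)"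
    using assms by (subst Comp_Comp [symmetric]) simp_all
  also have "\<dots> = \<langle>u, \<one> A\<rangle> \<cdot> f"
    using assms Curry_Eval [of C A f B] by simp
  finally show ?thesis .
qed

lemma Pair_Curry_Eval_Comp [simp]:
  assumes "C \<in> Obj X" "A \<in> Obj X" "u \<in> Arr X" "f \<in> Arr X" "Dom X f = C \<otimes> A" "Cod X f = B"
    "Dom X u = A" "Cod X u = C" "k \<in> Arr X" "Dom X k = B"
  shows "\<langle>u, \<Lambda> C A f\<rangle> \<cdot> (\<epsilon> C B \<cdot> k) = \<langle>u, \<one> A\<rangle> \<cdot> (f \<cdot> k)"
proof -
  have [simp]: "B \<in> Obj X" using assms by auto
  have "\<langle>u, \<Lambda> C A f\<rangle> \<cdot> (\<epsilon> C B \<cdot> k) = (\<langle>u, \<Lambda> C A f\<rangle> \<cdot> \<epsilon> C B) \<cdot> k"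
    using assms by (subst Comp_Comp) simp_all
  then show ?thesis using assms by simp
qed

lemma Comp_Curry [simp]:
  assumes "C \<in> Obj X" "A \<in> Obj X" "f \<in> Arr X" "Dom X f = C \<otimes> A" "h \<in> Arr X" "Cod X h = A"
  shows "h \<cdot> \<Lambda> C A f = \<Lambda> C (Dom X h) ((\<one> C \<boxtimes> h) \<cdot> f)"
proof (rule Curry_unique [of C "Cod X f"])
  have "(\<one> C \<boxtimes> (h \<cdot> \<Lambda> C A f)) \<cdot> \<epsilon> C (Cod X f) =
      (\<one> C \<boxtimes> h) \<cdot> ((\<one> C \<boxtimes> \<Lambda> C A f) \<cdot> \<epsilon> C (Cod X f))"
    using assms by (subst Comp_Comp [of "\<one> C \<boxtimes> h", symmetric]) (simp_all del: Pair_Curry_Eval)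
  also have "\<dots> = (\<one> C \<boxtimes> h) \<cdot> f"
    using assms Curry_Eval [of C A f "Cod X f"] by simp
  finally show "(\<one> C \<boxtimes> (h \<cdot> \<Lambda> C A f)) \<cdot> \<epsilon> C (Cod X f) = (\<one> C \<boxtimes> h) \<cdot> f" .
qed (use assms in simp_all)

lemma Comp_Curry_Comp [simp]:
  assumes "C \<in> Obj X" "A \<in> Obj X" "f \<in> Arr X" "Dom X f = C \<otimes> A" "h \<in> Arr X" "Cod X h = A"
    "k \<in> Arr X" "Dom X k = \<^bold>[C, Cod X f\<^bold>]"
  shows "h \<cdot> (\<Lambda> C A f \<cdot> k) = \<Lambda> C (Dom X h) ((\<one> C \<boxtimes> h) \<cdot> f) \<cdot> k"
  using assms by (subst Comp_Comp [symmetric]) simp_all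

lemma uncurry_Comp:
  assumes "C \<in> Obj X" "B \<in> Obj X" "h \<in> Arr X" "g \<in> Arr X" "Cod X h = Dom X g" "Cod X g = \<^bold>[C, B\<^bold>]"
  shows "uncurry C B (h \<cdot> g) = (\<one> C \<boxtimes> h) \<cdot> uncurry C B g"
  using assms by (auto simp: uncurry_def)

lemma uncurry_Add:
  assumes "C \<in> Obj X" "B \<in> Obj X" "g \<in> Arr X" "h \<in> Arr X" "Dom X g = Dom X h"
    "Cod X g = \<^bold>[C, B\<^bold>]" "Cod X h = \<^bold>[C, B\<^bold>]"
  shows "uncurry C B (g \<oplus> h) = uncurry C B g \<oplus> uncurry C B h"
proof -
  have "Dom X h \<in> Obj X" using assms by simp
  then have "g \<oplus> h = \<Lambda> C (Dom X h) (uncurry C B g \<oplus> uncurry C B h)"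
    using assms by (subst Curry_Add [of _ _ _ B]) auto
  then show ?thesis using assms \<open>Dom X h \<in> Obj X\<close> by auto
qed

lemma uncurry_Zero [simp]:
  assumes "A \<in> Obj X" "C \<in> Obj X" "B \<in> Obj X"
  shows "uncurry C B (\<zero> A \<^bold>[C, B\<^bold>]) = \<zero> (C \<otimes> A) B"
  using assms Curry_Zero [of C A B, symmetric] by simp

lemma Curry_eqI:
  assumes "C \<in> Obj X" "A \<in> Obj X" "f \<in> hom X (C \<otimes> A) B" "g \<in> hom X (C \<otimes> A) B"
    "\<Lambda> C A f = \<Lambda> C A g"
  shows "f = g"
proof -
  have "f = uncurry C B (\<Lambda> C A f)" using assms(1-3) by simp
  also have "\<dots> = uncurry C B (\<Lambda> C A g)" by (simp only: assms(5))
  also have "\<dots> = g" using assms(1,2,4) by simp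
  finally show ?thesis .
qed

lemma exp_map_type [simp]:
  assumes "f \<in> Arr X" "g \<in> Arr X"
  shows "exp_map f g \<in> Arr X" "Dom X (exp_map f g) = \<^bold>[Cod X f, Dom X g\<^bold>]"
    "Cod X (exp_map f g) = \<^bold>[Dom X f, Cod X g\<^bold>]"
  using assms by (simp_all add: exp_map_def Let_def)

lemma exp_mult_type [simp]:
  assumes "C \<in> Obj X" "A \<in> Obj X"
  shows "exp_mult C A \<in> Arr X" "Dom X (exp_mult C A) = \<^bold>[C, \<^bold>[C, A\<^bold>]\<^bold>]"
    "Cod X (exp_mult C A) = \<^bold>[C, A\<^bold>]"
  using assms by (simp_all add: exp_mult_def)

lemma exp_unit_type [simp]:
  assumes "C \<in> Obj X" "A \<in> Obj X"
  shows "exp_unit C A \<in> Arr X" "Dom X (exp_unit C A) = A" "Cod X (exp_unit C A) = \<^bold>[C, A\<^bold>]"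
  using assms by (simp_all add: exp_unit_def)

lemma Curry_exp_map:
  assumes "A \<in> Obj X" "h \<in> hom X C' C" "g \<in> hom X B B'" "f \<in> hom X (C \<otimes> A) B"
  shows "\<Lambda> C A f \<cdot> exp_map h g = \<Lambda> C' A ((h \<boxtimes> \<one> A) \<cdot> (f \<cdot> g))"
proof -
  have "C \<in> Obj X" "C' \<in> Obj X" "B \<in> Obj X" "B' \<in> Obj X" using assms by auto
  with assms show ?thesis by (simp add: exp_map_def Let_def)
qed

lemma Curry_exp_unit:
  assumes "C \<in> Obj X" "g \<in> hom X A B"
  shows "g \<cdot> exp_unit C B = \<Lambda> C A (\<pi>\<^sub>1 C A \<cdot> g)"
proof -
  have "A \<in> Obj X" "B \<in> Obj X" using assms by auto
  with assms show ?thesis by (simp add: exp_unit_def)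
qed

lemma Curry_exp_mult:
  assumes "C \<in> Obj X" "A \<in> Obj X" "f \<in> hom X (C \<otimes> A) \<^bold>[C, B\<^bold>]" "B \<in> Obj X"
  shows "\<Lambda> C A f \<cdot> exp_mult C B = \<Lambda> C A (\<langle>\<pi>\<^sub>0 C A, f\<rangle> \<cdot> \<epsilon> C B)"
  using assms by (simp add: exp_mult_def)

text \<open>
  With a parameter of type \<open>C\<close> in scope, composing \<open>f (c, a)\<close> into \<open>g (c, b)\<close> is Kleisli
  composition for the monad \<open>[C, _]\<close>. Stating it for an arbitrary \<open>m\<close> in place of a curried map makes it
  usable also for \<open>m = 1\<close>, where it computes the Kleisli extension of \<open>g\<close> itself.
\<close>

lemma Curry_Kleisli:
  assumes "C \<in> Obj X" "m \<in> hom X A \<^bold>[C, B\<^bold>]" "B \<in> Obj X" "g \<in> hom X (C \<otimes> B) D"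
  shows "m \<cdot> (exp_map (\<one> C) (\<Lambda> C B g) \<cdot> exp_mult C D) = \<Lambda> C A (\<langle>\<pi>\<^sub>0 C A, uncurry C B m\<rangle> \<cdot> g)"
proof -
  have [simp]: "A \<in> Obj X" "D \<in> Obj X" using assms by auto
  define f where "f = uncurry C B m"
  have f: "f \<in> hom X (C \<otimes> A) B" "m = \<Lambda> C A f" using assms by (simp_all add: f_def)
  have "m \<cdot> (exp_map (\<one> C) (\<Lambda> C B g) \<cdot> exp_mult C D) =
      (\<Lambda> C A f \<cdot> exp_map (\<one> C) (\<Lambda> C B g)) \<cdot> exp_mult C D"
    using assms f by simp
  also have "\<Lambda> C A f \<cdot> exp_map (\<one> C) (\<Lambda> C B g) = \<Lambda> C A (f \<cdot> \<Lambda> C B g)"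
    using assms f by (subst Curry_exp_map [of _ _ C _ _ B]) simp_all
  also have "\<Lambda> C A (f \<cdot> \<Lambda> C B g) \<cdot> exp_mult C D = \<Lambda> C A (\<langle>\<pi>\<^sub>0 C A, f \<cdot> \<Lambda> C B g\<rangle> \<cdot> \<epsilon> C D)"
    using assms f by (intro Curry_exp_mult) simp_all
  also have "\<dots> = \<Lambda> C A (\<langle>\<pi>\<^sub>0 C A, f\<rangle> \<cdot> g)"
    using assms f by simp
  finally show ?thesis by (simp only: f_def)
qed

text \<open>
  The uncurrying map that sends \<open>\<phi>\<close> to \<open>(c, a) \<mapsto> \<phi> a c\<close>. Reindexing along both projections gives
  \<open>(c, a) \<mapsto> (c', a') \<mapsto> \<phi> a c'\<close>, and the multiplication then restricts to the diagonal. This detour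
  uses only maps that are preserved by an exponentiable linearizing combinator.
\<close>

definition exp_prod :: "'o \<Rightarrow> 'o \<Rightarrow> 'o \<Rightarrow> 'm"
  where "exp_prod C A D =
    exp_map (\<pi>\<^sub>1 C A) (exp_map (\<pi>\<^sub>0 C A) (\<one> D)) \<cdot> exp_mult (C \<otimes> A) D"

lemma exp_prod_type [simp]:
  assumes "C \<in> Obj X" "A \<in> Obj X" "D \<in> Obj X"
  shows "exp_prod C A D \<in> Arr X" "Dom X (exp_prod C A D) = \<^bold>[A, \<^bold>[C, D\<^bold>]\<^bold>]"
    "Cod X (exp_prod C A D) = \<^bold>[C \<otimes> A, D\<^bold>]"
  using assms by (simp_all add: exp_prod_def)

lemma Curry_Curry_exp_prod:
  assumes "C \<in> Obj X" "A \<in> Obj X" "B \<in> Obj X" "k \<in> hom X (C \<otimes> (A \<otimes> B)) D"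
  shows "\<Lambda> A B (\<Lambda> C (A \<otimes> B) k) \<cdot> exp_prod C A D =
    \<Lambda> (C \<otimes> A) B (iso_inv (assoc_map C A B) \<cdot> k)"
proof -
  have [simp]: "D \<in> Obj X" using assms by auto
  let ?P = "C \<otimes> A"
  let ?i = "\<langle>\<pi>\<^sub>0 ?P B \<cdot> \<pi>\<^sub>1 C A, \<pi>\<^sub>1 ?P B\<rangle>"
  have "\<Lambda> A B (\<Lambda> C (A \<otimes> B) k) \<cdot> exp_prod C A D =
      (\<Lambda> A B (\<Lambda> C (A \<otimes> B) k) \<cdot> exp_map (\<pi>\<^sub>1 C A) (exp_map (\<pi>\<^sub>0 C A) (\<one> D))) \<cdot> exp_mult ?P D"
    using assms by (simp add: exp_prod_def)
  also have "\<Lambda> A B (\<Lambda> C (A \<otimes> B) k) \<cdot> exp_map (\<pi>\<^sub>1 C A) (exp_map (\<pi>\<^sub>0 C A) (\<one> D)) =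
      \<Lambda> ?P B (?i \<cdot> (\<Lambda> C (A \<otimes> B) k \<cdot> exp_map (\<pi>\<^sub>0 C A) (\<one> D)))"
    using assms by (subst Curry_exp_map [of _ _ ?P _ _ "\<^bold>[C, D\<^bold>]"]) simp_all
  also have "\<Lambda> C (A \<otimes> B) k \<cdot> exp_map (\<pi>\<^sub>0 C A) (\<one> D) =
      \<Lambda> ?P (A \<otimes> B) ((\<pi>\<^sub>0 C A \<boxtimes> \<one> (A \<otimes> B)) \<cdot> k)"
    using assms by (subst Curry_exp_map [of _ _ ?P _ _ D]) simp_all
  also have "\<Lambda> ?P B (?i \<cdot> \<Lambda> ?P (A \<otimes> B) ((\<pi>\<^sub>0 C A \<boxtimes> \<one> (A \<otimes> B)) \<cdot> k)) \<cdot> exp_mult ?P D =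
      \<Lambda> ?P B (\<langle>\<pi>\<^sub>0 ?P B, ?i \<cdot> \<Lambda> ?P (A \<otimes> B) ((\<pi>\<^sub>0 C A \<boxtimes> \<one> (A \<otimes> B)) \<cdot> k)\<rangle> \<cdot> \<epsilon> ?P D)"
    using assms by (intro Curry_exp_mult) simp_all
  also have "\<dots> = \<Lambda> ?P B (iso_inv (assoc_map C A B) \<cdot> k)"
    using assms by (simp add: iso_inv_assoc_map)
  finally show ?thesis .
qed

end

section \<open>The differential combinator of a linearizing system\<close>

context linearizing_system
begin

lemma LS_type [simp]:
  assumes "C \<in> Obj X" "A \<in> Obj X" "f \<in> Arr X" "Dom X f = C \<otimes> A"
  shows "LS C A f \<in> Arr X" "Dom X (LS C A f) = C \<otimes> A" "Cod X (LS C A f) = Cod X f"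
  using LS_hom [of C A f "Cod X f"] assms by simp_all

lemma LS_zero_argument:
  assumes "C \<in> Obj X" "A \<in> Obj X" "f \<in> Arr X" "Dom X f = C \<otimes> A"
    and "u \<in> Arr X" "Dom X u = Z" "Cod X u = C"
  shows "\<langle>u, \<zero> Z A\<rangle> \<cdot> LS C A f = \<zero> Z (Cod X f)"
proof -
  have [simp]: "Z \<in> Obj X" using assms by auto
  have "\<langle>u, \<zero> Z A\<rangle> \<cdot> LS C A f = \<langle>u, \<zero> Z A\<rangle> \<cdot> (\<langle>\<pi>\<^sub>0 C A, \<zero> (C \<otimes> A) A\<rangle> \<cdot> LS C A f)"
    using assms by simp
  also have "\<dots> = \<langle>u, \<zero> Z A\<rangle> \<cdot> \<zero> (C \<otimes> A) (Cod X f)"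
    using LS2_Zero [of C A f "Cod X f"] assms by (simp only: in_hom simp_thms)
  also have "\<dots> = \<zero> Z (Cod X f)" using assms by simp
  finally show ?thesis .
qed

lemma LS_sum_argument:
  assumes "C \<in> Obj X" "A \<in> Obj X" "f \<in> Arr X" "Dom X f = C \<otimes> A"
    and "u \<in> hom X Z C" "v \<in> hom X Z A" "w \<in> hom X Z A"
  shows "\<langle>u, v \<oplus> w\<rangle> \<cdot> LS C A f = \<langle>u, v\<rangle> \<cdot> LS C A f \<oplus> \<langle>u, w\<rangle> \<cdot> LS C A f"
proof -
  have "\<langle>u, v \<oplus> w\<rangle> \<cdot> LS C A f = \<langle>u, \<langle>v, w\<rangle>\<rangle> \<cdot> ((\<one> C \<boxtimes> sum_map A) \<cdot> LS C A f)"
    using assms by (simp add: sum_map_def)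
  also have "\<dots> = \<langle>u, \<langle>v, w\<rangle>\<rangle> \<cdot>
      ((\<one> C \<boxtimes> \<pi>\<^sub>0 A A) \<cdot> LS C A f \<oplus> (\<one> C \<boxtimes> \<pi>\<^sub>1 A A) \<cdot> LS C A f)"
    using LS2_Add [of C A f "Cod X f"] assms by (simp only: in_hom simp_thms)
  also have "\<dots> = \<langle>u, v\<rangle> \<cdot> LS C A f \<oplus> \<langle>u, w\<rangle> \<cdot> LS C A f"
    using assms by simp
  finally show ?thesis .
qed

text \<open>
  A map that ignores the argument to be linearized has linear part \<open>0\<close>: it factors through the zero map,
  and linear parts vanish at \<open>0\<close>.
\<close>

lemma LS_const:
  assumes "C \<in> Obj X" "A \<in> Obj X" "g \<in> Arr X" "Dom X g = C"
  shows "LS C A (\<pi>\<^sub>0 C A \<cdot> g) = \<zero> (C \<otimes> A) (Cod X g)"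
  using LS5 [of C A A "\<zero> (C \<otimes> A) A" "\<pi>\<^sub>0 C A \<cdot> g" "Cod X g"] assms
  by (simp add: LS1_Zero LS_zero_argument)

lemma LS_reindex:
  assumes "A \<in> Obj X" "f \<in> Arr X" "Dom X f = C \<otimes> A" "h \<in> Arr X" "Dom X h = C'" "Cod X h = C"
  shows "LS C' A (\<langle>\<pi>\<^sub>0 C' A \<cdot> h, \<pi>\<^sub>1 C' A\<rangle> \<cdot> f) = \<langle>\<pi>\<^sub>0 C' A \<cdot> h, \<pi>\<^sub>1 C' A\<rangle> \<cdot> LS C A f"
proof -
  have "C \<in> Obj X" "C' \<in> Obj X" using assms by auto
  then show ?thesis using LS8 [of h C' C A f "Cod X f"] assms by simp
qed

text \<open>
  When the inner map is linear and ignores the parameter, the translation by its value at \<open>0\<close>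
  in the chain rule is trivial, because a linear map vanishes at \<open>0\<close>.
\<close>

lemma LS_precompose_linear:
  assumes "C \<in> Obj X" "h \<in> hom X A B" "LS C A (\<pi>\<^sub>1 C A \<cdot> h) = \<pi>\<^sub>1 C A \<cdot> h"
    and "k \<in> Arr X" "Dom X k = C \<otimes> B"
  shows "LS C A (\<langle>\<pi>\<^sub>0 C A, \<pi>\<^sub>1 C A \<cdot> h\<rangle> \<cdot> k) = \<langle>\<pi>\<^sub>0 C A, \<pi>\<^sub>1 C A \<cdot> h\<rangle> \<cdot> LS C B k"
proof -
  have [simp]: "A \<in> Obj X" "B \<in> Obj X" using assms(2) by auto
  have "\<langle>\<pi>\<^sub>0 C B, \<zero> (C \<otimes> B) A\<rangle> \<cdot> LS C A (\<pi>\<^sub>1 C A \<cdot> h) = \<zero> (C \<otimes> B) B"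
    using assms(1,2) by (subst LS_zero_argument) simp_all
  then have [simp]: "\<zero> (C \<otimes> B) A \<cdot> h = \<zero> (C \<otimes> B) B"
    using assms(1,2) by (simp add: assms(3))
  show ?thesis
    using LS5 [of C A B "\<pi>\<^sub>1 C A \<cdot> h" k "Cod X k"] assms by simp
qed

lemma LS_inject0:
  assumes "C \<in> Obj X" "A \<in> Obj X" "B \<in> Obj X" "k \<in> Arr X" "Dom X k = C \<otimes> (A \<otimes> B)"
  shows "LS C A (\<langle>\<pi>\<^sub>0 C A, \<langle>\<pi>\<^sub>1 C A, \<zero> (C \<otimes> A) B\<rangle>\<rangle> \<cdot> k)
    = \<langle>\<pi>\<^sub>0 C A, \<langle>\<pi>\<^sub>1 C A, \<zero> (C \<otimes> A) B\<rangle>\<rangle> \<cdot> LS C (A \<otimes> B) k"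
  using LS_precompose_linear [of C "\<langle>\<one> A, \<zero> A B\<rangle>" A "A \<otimes> B" k] assms
  by (simp add: LS4 [of _ _ _ A _ B] LS3_Proj1 LS1_Zero)

lemma LS_inject1:
  assumes "C \<in> Obj X" "A \<in> Obj X" "B \<in> Obj X" "k \<in> Arr X" "Dom X k = C \<otimes> (B \<otimes> A)"
  shows "LS C A (\<langle>\<pi>\<^sub>0 C A, \<langle>\<zero> (C \<otimes> A) B, \<pi>\<^sub>1 C A\<rangle>\<rangle> \<cdot> k)
    = \<langle>\<pi>\<^sub>0 C A, \<langle>\<zero> (C \<otimes> A) B, \<pi>\<^sub>1 C A\<rangle>\<rangle> \<cdot> LS C (B \<otimes> A) k"
  using LS_precompose_linear [of C "\<langle>\<zero> A B, \<one> A\<rangle>" A "B \<otimes> A" k] assms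
  by (simp add: LS4 [of _ _ _ B _ A] LS3_Proj1 LS1_Zero)

text \<open>
  Linear parts are additive, so the linear part in a pair of variables is determined on the two
  axes, and on each axis it is the linear part of the restriction, since the inclusions of the axes are
  linear.
\<close>

lemma LS_split:
  assumes "C \<in> Obj X" "A \<in> Obj X" "B \<in> Obj X" "k \<in> Arr X" "Dom X k = C \<otimes> (A \<otimes> B)"
  shows "LS C (A \<otimes> B) k =
    (\<one> C \<boxtimes> \<pi>\<^sub>0 A B) \<cdot> LS C A (\<langle>\<pi>\<^sub>0 C A, \<langle>\<pi>\<^sub>1 C A, \<zero> (C \<otimes> A) B\<rangle>\<rangle> \<cdot> k) \<oplus>
    (\<one> C \<boxtimes> \<pi>\<^sub>1 A B) \<cdot> LS C B (\<langle>\<pi>\<^sub>0 C B, \<langle>\<zero> (C \<otimes> B) A, \<pi>\<^sub>1 C B\<rangle>\<rangle> \<cdot> k)"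
  (is "_ = ?sum")
proof -
  let ?Z = "C \<otimes> (A \<otimes> B)" and ?y = "\<pi>\<^sub>1 C (A \<otimes> B)"
  let ?l = "\<langle>?y \<cdot> \<pi>\<^sub>0 A B, \<zero> ?Z B\<rangle>" and ?r = "\<langle>\<zero> ?Z A, ?y \<cdot> \<pi>\<^sub>1 A B\<rangle>"
  have "?l \<oplus> ?r = ?y" using assms by simp
  then have "\<one> ?Z = \<langle>\<pi>\<^sub>0 C (A \<otimes> B), ?l \<oplus> ?r\<rangle>"
    using assms by (simp only: Pair_Proj Prod_Obj)
  then have "LS C (A \<otimes> B) k = \<langle>\<pi>\<^sub>0 C (A \<otimes> B), ?l \<oplus> ?r\<rangle> \<cdot> LS C (A \<otimes> B) k"
    using assms Ident_Comp [of "LS C (A \<otimes> B) k" ?Z] by (simp only: LS_type Prod_Obj)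
  also have "\<dots> = \<langle>\<pi>\<^sub>0 C (A \<otimes> B), ?l\<rangle> \<cdot> LS C (A \<otimes> B) k \<oplus> \<langle>\<pi>\<^sub>0 C (A \<otimes> B), ?r\<rangle> \<cdot> LS C (A \<otimes> B) k"
    by (rule LS_sum_argument [of _ _ _ _ ?Z]) (use assms in simp_all)
  also have "\<dots> = ?sum"
    using assms by (simp add: LS_inject0 LS_inject1)
  finally show ?thesis .
qed

abbreviation deriv :: "'m \<Rightarrow> 'm"
  where "deriv \<equiv> sys_differential LS"

lemma deriv_eq: "Dom X f = A \<Longrightarrow> deriv f = LS A A ((\<pi>\<^sub>0 A A \<oplus> \<pi>\<^sub>1 A A) \<cdot> f)"
  by (simp add: sys_differential_def sum_map_def)

lemma deriv_type [simp]:
  assumes "f \<in> Arr X"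
  shows "deriv f \<in> Arr X" "Dom X (deriv f) = Dom X f \<otimes> Dom X f" "Cod X (deriv f) = Cod X f"
  using assms by (simp_all add: deriv_eq [OF refl])

text \<open>
  The chain rule of a system takes the linear part of \<open>u\<close> followed by \<open>v\<close> to that of \<open>u\<close> followed by the
  linear part of \<open>v\<close> translated by \<open>u 0\<close>. Here \<open>u\<close> is \<open>x \<mapsto> f (a + x)\<close>, whose value at \<open>0\<close> is \<open>f a\<close>, so the second factor is the derivative of
  \<open>g\<close> at \<open>f a\<close>.
\<close>

lemma deriv_chain:
  assumes "f \<in> hom X A B" "g \<in> hom X B C"
  shows "deriv (f \<cdot> g) = \<langle>\<pi>\<^sub>0 A A \<cdot> f, deriv f\<rangle> \<cdot> deriv g"
proof -
  have [simp]: "A \<in> Obj X" "B \<in> Obj X" "C \<in> Obj X" using assms by auto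
  let ?s = "\<pi>\<^sub>0 A A \<oplus> \<pi>\<^sub>1 A A"
  have "deriv (f \<cdot> g) = LS A A (\<langle>\<pi>\<^sub>0 A A, ?s \<cdot> f\<rangle> \<cdot> (\<pi>\<^sub>1 A B \<cdot> g))"
    using assms by (simp add: deriv_eq [of _ A])
  also have "\<dots> = \<langle>\<pi>\<^sub>0 A A, deriv f\<rangle> \<cdot>
      LS A B (\<langle>\<pi>\<^sub>0 A B, \<pi>\<^sub>1 A B \<oplus> \<langle>\<pi>\<^sub>0 A B, \<zero> (A \<otimes> B) A\<rangle> \<cdot> (?s \<cdot> f)\<rangle> \<cdot> (\<pi>\<^sub>1 A B \<cdot> g))"
    using assms LS5 [of A A B "?s \<cdot> f" "\<pi>\<^sub>1 A B \<cdot> g" C] by (simp add: deriv_eq [of f A])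
  also have "\<dots> = \<langle>\<pi>\<^sub>0 A A, deriv f\<rangle> \<cdot>
      LS A B (\<langle>\<pi>\<^sub>0 A B \<cdot> f, \<pi>\<^sub>1 A B\<rangle> \<cdot> ((\<pi>\<^sub>0 B B \<oplus> \<pi>\<^sub>1 B B) \<cdot> g))"
    using assms Add_swap [of "\<pi>\<^sub>1 A B" "\<pi>\<^sub>0 A B \<cdot> f"] by simp
  also have "\<dots> = \<langle>\<pi>\<^sub>0 A A, deriv f\<rangle> \<cdot> (\<langle>\<pi>\<^sub>0 A B \<cdot> f, \<pi>\<^sub>1 A B\<rangle> \<cdot> deriv g)"
    using assms by (subst LS_reindex [where C = B]) (simp_all add: deriv_eq [of g B])
  also have "\<dots> = \<langle>\<pi>\<^sub>0 A A \<cdot> f, deriv f\<rangle> \<cdot> deriv g"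
    using assms by simp
  finally show ?thesis .
qed

text \<open>
  The second derivative is the linear part of \<open>(x, y) \<mapsto> D f (a + x, b + y)\<close>. The lift map sets the
  base point to \<open>(a, 0)\<close> and the direction to \<open>(0, y)\<close>, which leaves the linear part of
  \<open>D f (a, y)\<close> in \<open>y\<close>; linearization being idempotent, this is \<open>D f\<close> again.
\<close>

lemma deriv_lift:
  assumes "f \<in> hom X A B"
  shows "lift_map A A A A \<cdot> deriv (deriv f) = deriv f"
proof -
  have [simp]: "A \<in> Obj X" "B \<in> Obj X" using assms by auto
  let ?P = "A \<otimes> A"
  let ?k = "(\<pi>\<^sub>0 ?P ?P \<oplus> \<pi>\<^sub>1 ?P ?P) \<cdot> deriv f"
  \<comment> \<open>The lift map is \<open>?i\<close> followed by \<open>?j\<close>: precomposing with \<open>?j\<close> only changes the parameter, and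
    \<open>?i\<close> restricts the linear argument to an axis.\<close>
  let ?i = "\<langle>\<pi>\<^sub>0 A A, \<langle>\<zero> ?P A, \<pi>\<^sub>1 A A\<rangle>\<rangle>"
  let ?j = "\<langle>\<pi>\<^sub>0 A ?P \<cdot> \<langle>\<one> A, \<zero> A A\<rangle>, \<pi>\<^sub>1 A ?P\<rangle>"
  have "lift_map A A A A \<cdot> deriv (deriv f) = ?i \<cdot> (?j \<cdot> LS ?P ?P ?k)"
    using assms by (simp add: lift_map_def deriv_eq [of "deriv f" ?P])
  also have "\<dots> = LS A A (?i \<cdot> (?j \<cdot> ?k))"
    using assms
    by (simp only: LS_reindex LS_inject1 in_hom deriv_type Comp_type Pair_type Proj_type Add_type
        Ident_type Zero_type Prod_Obj \<open>A \<in> Obj X\<close> \<open>B \<in> Obj X\<close>)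
  also have "?i \<cdot> (?j \<cdot> ?k) = deriv f" using assms by simp
  also have "LS A A (deriv f) = deriv f"
    using assms by (simp add: deriv_eq [of f A] LS6 [of _ _ _ B])
  finally show ?thesis .
qed

text \<open>
  Both sides are iterated partial linearizations of \<open>F (a, (p, q)) = f (a + p + q)\<close>. Linearizing \<open>F\<close> in
  \<open>p\<close> gives \<open>D f (a + q, p)\<close>, and linearizing this in \<open>q\<close> gives the left-hand side; the other order
  gives the right-hand side with the roles of \<open>p\<close> and \<open>q\<close> exchanged.
\<close>

lemma LS_shifted_deriv_symmetric:
  assumes "f \<in> hom X A B"
  defines "P \<equiv> A \<otimes> A"
  defines "Q \<equiv> \<langle>\<pi>\<^sub>0 P A \<cdot> \<pi>\<^sub>0 A A \<oplus> \<pi>\<^sub>1 P A, \<pi>\<^sub>0 P A \<cdot> \<pi>\<^sub>1 A A\<rangle> \<cdot> deriv f"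
  shows "assoc_map A A A \<cdot> LS P A Q = assoc_swap A A A \<cdot> LS P A Q"
proof -
  have [simp]: "A \<in> Obj X" "B \<in> Obj X" "P \<in> Obj X" using assms by (auto simp: P_def)
  have P: "A \<otimes> A = P" by (simp add: P_def)
  define s where "s = \<pi>\<^sub>0 A A \<oplus> \<pi>\<^sub>1 A A"
  define F where "F = (\<pi>\<^sub>0 A P \<oplus> (\<pi>\<^sub>1 A P \<cdot> \<pi>\<^sub>0 A A \<oplus> \<pi>\<^sub>1 A P \<cdot> \<pi>\<^sub>1 A A)) \<cdot> f"
  have F: "F \<in> hom X (A \<otimes> P) B" using assms by (simp add: F_def)
  \<comment> \<open>Linearizing \<open>f (a + p + q)\<close> in its last summand gives the derivative of \<open>f\<close> at \<open>a + p\<close>.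
    Both partial linearizations of \<open>F\<close> have this form, as \<open>F\<close> is symmetric in \<open>p\<close> and \<open>q\<close>.\<close>
  have shift: "LS P A ((\<pi>\<^sub>0 P A \<cdot> \<pi>\<^sub>0 A A \<oplus> (\<pi>\<^sub>0 P A \<cdot> \<pi>\<^sub>1 A A \<oplus> \<pi>\<^sub>1 P A)) \<cdot> f) =
      \<langle>\<pi>\<^sub>0 P A \<cdot> s, \<pi>\<^sub>1 P A\<rangle> \<cdot> deriv f"
    using LS_reindex [of A "s \<cdot> f" A s P] assms
    by (simp add: deriv_eq [of f A] s_def Add_ac)
  have "iso_inv (assoc_map A A A) \<cdot> F = (\<pi>\<^sub>0 P A \<cdot> \<pi>\<^sub>0 A A \<oplus> (\<pi>\<^sub>0 P A \<cdot> \<pi>\<^sub>1 A A \<oplus> \<pi>\<^sub>1 P A)) \<cdot> f"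
    using assms by (simp add: iso_inv_assoc_map F_def)
  then have lin1: "sys_lin1 LS A A A F = assoc_map A A A \<cdot> (\<langle>\<pi>\<^sub>0 P A \<cdot> s, \<pi>\<^sub>1 P A\<rangle> \<cdot> deriv f)"
    by (simp add: sys_lin1_def P shift)
  have "iso_inv (assoc_swap A A A) \<cdot> F = (\<pi>\<^sub>0 P A \<cdot> \<pi>\<^sub>0 A A \<oplus> (\<pi>\<^sub>0 P A \<cdot> \<pi>\<^sub>1 A A \<oplus> \<pi>\<^sub>1 P A)) \<cdot> f"
    using assms by (simp add: iso_inv_assoc_swap F_def Add_swap)
  then have lin0: "sys_lin0 LS A A A F = assoc_swap A A A \<cdot> (\<langle>\<pi>\<^sub>0 P A \<cdot> s, \<pi>\<^sub>1 P A\<rangle> \<cdot> deriv f)"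
    by (simp add: sys_lin0_def P shift)
  have "sys_lin1 LS A A A (sys_lin0 LS A A A F) = assoc_map A A A \<cdot> LS P A Q"
    unfolding lin0 using assms
    by (simp add: sys_lin1_def iso_inv_assoc_map assoc_swap_def Q_def s_def)
  moreover have "sys_lin0 LS A A A (sys_lin1 LS A A A F) = assoc_swap A A A \<cdot> LS P A Q"
    unfolding lin1 using assms
    by (simp add: sys_lin0_def iso_inv_assoc_swap assoc_map_def Q_def s_def)
  ultimately show ?thesis
    using LS7 [of A A A F B] F by (simp add: P)
qed

text \<open>
  Along the axis \<open>y = 0\<close>, the map \<open>D f (a + x, b + y)\<close> is \<open>Q\<close>. Along \<open>x = 0\<close>, it is
  \<open>D f (a, b) + D f (a, y)\<close>, whose first summand is constant in \<open>y\<close> and whose second one is already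
  linear.
\<close>

lemma deriv_deriv_eq:
  assumes "f \<in> hom X A B"
  defines "P \<equiv> A \<otimes> A"
  defines "Q \<equiv> \<langle>\<pi>\<^sub>0 P A \<cdot> \<pi>\<^sub>0 A A \<oplus> \<pi>\<^sub>1 P A, \<pi>\<^sub>0 P A \<cdot> \<pi>\<^sub>1 A A\<rangle> \<cdot> deriv f"
  shows "deriv (deriv f) =
    (\<one> P \<boxtimes> \<pi>\<^sub>0 A A) \<cdot> LS P A Q \<oplus> (\<pi>\<^sub>0 A A \<boxtimes> \<pi>\<^sub>1 A A) \<cdot> deriv f"
proof -
  have [simp]: "A \<in> Obj X" "B \<in> Obj X" "P \<in> Obj X" using assms by (auto simp: P_def)
  have P: "A \<otimes> A = P" by (simp add: P_def)
  let ?k = "(\<pi>\<^sub>0 P P \<oplus> \<pi>\<^sub>1 P P) \<cdot> deriv f"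
  have D: "deriv f \<in> hom X P B" "deriv f = LS A A ((\<pi>\<^sub>0 A A \<oplus> \<pi>\<^sub>1 A A) \<cdot> f)"
    using assms by (simp_all add: P deriv_eq [of f A])
  have pi0: "\<pi>\<^sub>0 P A = \<langle>\<pi>\<^sub>0 P A \<cdot> \<pi>\<^sub>0 A A, \<pi>\<^sub>0 P A \<cdot> \<pi>\<^sub>1 A A\<rangle>"
    by (rule Pair_eqI [of A A _ "P \<otimes> A"]) (simp_all add: P)
  have eq: "\<pi>\<^sub>0 P A \<oplus> \<langle>\<pi>\<^sub>1 P A, \<zero> (P \<otimes> A) A\<rangle> = \<langle>\<pi>\<^sub>0 P A \<cdot> \<pi>\<^sub>0 A A \<oplus> \<pi>\<^sub>1 P A, \<pi>\<^sub>0 P A \<cdot> \<pi>\<^sub>1 A A\<rangle>"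
    "\<pi>\<^sub>0 P A \<oplus> \<langle>\<zero> (P \<otimes> A) A, \<pi>\<^sub>1 P A\<rangle> = \<langle>\<pi>\<^sub>0 P A \<cdot> \<pi>\<^sub>0 A A, \<pi>\<^sub>0 P A \<cdot> \<pi>\<^sub>1 A A \<oplus> \<pi>\<^sub>1 P A\<rangle>"
    by (rule Pair_eqI [of A A _ "P \<otimes> A"]; simp add: P)+
  have "\<langle>\<pi>\<^sub>0 P A, \<langle>\<pi>\<^sub>1 P A, \<zero> (P \<otimes> A) A\<rangle>\<rangle> \<cdot> ?k = Q"
    using D(1) by (simp add: P eq Q_def)
  moreover have "\<langle>\<pi>\<^sub>0 P A, \<langle>\<zero> (P \<otimes> A) A, \<pi>\<^sub>1 P A\<rangle>\<rangle> \<cdot> ?k =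
      \<pi>\<^sub>0 P A \<cdot> deriv f \<oplus> \<langle>\<pi>\<^sub>0 P A \<cdot> \<pi>\<^sub>0 A A, \<pi>\<^sub>1 P A\<rangle> \<cdot> deriv f"
  proof -
    have "\<langle>\<pi>\<^sub>0 P A \<cdot> \<pi>\<^sub>0 A A, \<pi>\<^sub>0 P A \<cdot> \<pi>\<^sub>1 A A \<oplus> \<pi>\<^sub>1 P A\<rangle> \<cdot> deriv f =
      \<langle>\<pi>\<^sub>0 P A \<cdot> \<pi>\<^sub>0 A A, \<pi>\<^sub>0 P A \<cdot> \<pi>\<^sub>1 A A\<rangle> \<cdot> deriv f \<oplus> \<langle>\<pi>\<^sub>0 P A \<cdot> \<pi>\<^sub>0 A A, \<pi>\<^sub>1 P A\<rangle> \<cdot> deriv f"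
      unfolding D(2) by (rule LS_sum_argument [of _ _ _ _ "P \<otimes> A"]) (use assms in \<open>simp_all add: P\<close>)
    then show ?thesis using D(1) by (simp add: P eq pi0 [symmetric])
  qed
  moreover have "LS P A (\<pi>\<^sub>0 P A \<cdot> deriv f) = \<zero> (P \<otimes> A) B"
    using D(1) LS_const [of P A "deriv f"] by simp
  moreover have "LS P A (\<langle>\<pi>\<^sub>0 P A \<cdot> \<pi>\<^sub>0 A A, \<pi>\<^sub>1 P A\<rangle> \<cdot> deriv f) = \<langle>\<pi>\<^sub>0 P A \<cdot> \<pi>\<^sub>0 A A, \<pi>\<^sub>1 P A\<rangle> \<cdot> deriv f"
  proof -
    have "LS A A (deriv f) = deriv f"
      unfolding D(2) by (rule LS6 [of _ _ _ B]) (use assms in \<open>simp_all add: P\<close>)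
    then show ?thesis using D(1) LS_reindex [of A "deriv f" A "\<pi>\<^sub>0 A A" P] by (simp add: P)
  qed
  ultimately have "LS P A (\<langle>\<pi>\<^sub>0 P A, \<langle>\<pi>\<^sub>1 P A, \<zero> (P \<otimes> A) A\<rangle>\<rangle> \<cdot> ?k) = LS P A Q"
    "LS P A (\<langle>\<pi>\<^sub>0 P A, \<langle>\<zero> (P \<otimes> A) A, \<pi>\<^sub>1 P A\<rangle>\<rangle> \<cdot> ?k) = \<langle>\<pi>\<^sub>0 P A \<cdot> \<pi>\<^sub>0 A A, \<pi>\<^sub>1 P A\<rangle> \<cdot> deriv f"
    using D(1) by (simp_all add: LS1_Add [of P A _ B] P)
  moreover have "deriv (deriv f) = LS P (A \<otimes> A) ?k"
    using D(1) by (simp add: deriv_eq [of "deriv f" P] P)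
  ultimately show ?thesis
    using LS_split [of P A A ?k] D(1) by (simp add: P)
qed

lemma deriv_interchange:
  assumes "f \<in> hom X A B"
  shows "interchange A A A A \<cdot> deriv (deriv f) = deriv (deriv f)"
proof -
  have [simp]: "A \<in> Obj X" "B \<in> Obj X" using assms by auto
  let ?P = "A \<otimes> A"
  define R where
    "R = LS ?P A (\<langle>\<pi>\<^sub>0 ?P A \<cdot> \<pi>\<^sub>0 A A \<oplus> \<pi>\<^sub>1 ?P A, \<pi>\<^sub>0 ?P A \<cdot> \<pi>\<^sub>1 A A\<rangle> \<cdot> deriv f)"
  have R: "R \<in> hom X (?P \<otimes> A) B" using assms by (simp add: R_def)
  \<comment> \<open>\<open>?t\<close> sends \<open>((a, b), (a', b'))\<close> to \<open>(a, (b, a'))\<close>, the arguments on which the mixed term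
    depends.\<close>
  let ?t = "\<langle>\<pi>\<^sub>0 ?P ?P \<cdot> \<pi>\<^sub>0 A A, \<langle>\<pi>\<^sub>0 ?P ?P \<cdot> \<pi>\<^sub>1 A A, \<pi>\<^sub>1 ?P ?P \<cdot> \<pi>\<^sub>0 A A\<rangle>\<rangle>"
  have "?t \<cdot> (assoc_map A A A \<cdot> R) = ?t \<cdot> (assoc_swap A A A \<cdot> R)"
    using LS_shifted_deriv_symmetric [OF assms] by (simp only: R_def)
  then have "\<langle>\<pi>\<^sub>0 ?P ?P, \<pi>\<^sub>1 ?P ?P \<cdot> \<pi>\<^sub>0 A A\<rangle> \<cdot> R =
      \<langle>\<langle>\<pi>\<^sub>0 ?P ?P \<cdot> \<pi>\<^sub>0 A A, \<pi>\<^sub>1 ?P ?P \<cdot> \<pi>\<^sub>0 A A\<rangle>, \<pi>\<^sub>0 ?P ?P \<cdot> \<pi>\<^sub>1 A A\<rangle> \<cdot> R"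
    using R by (simp add: assoc_map_def assoc_swap_def)
  moreover have "deriv (deriv f) =
      (\<one> ?P \<boxtimes> \<pi>\<^sub>0 A A) \<cdot> R \<oplus> (\<pi>\<^sub>0 A A \<boxtimes> \<pi>\<^sub>1 A A) \<cdot> deriv f"
    using deriv_deriv_eq [OF assms] by (simp only: R_def)
  ultimately show ?thesis
    using assms R by (simp add: interchange_def)
qed

lemma differential_combinator_deriv: "differential_combinator X deriv"
proof unfold_locales
  fix A B f g
  assume fg: "f \<in> hom X A B" "g \<in> hom X A B"
  then have "A \<in> Obj X" "B \<in> Obj X" by auto
  with fg show "deriv (f \<oplus> g) = deriv f \<oplus> deriv g"
    by (simp add: deriv_eq [of _ A] LS1_Add [of _ _ _ B])
next
  fix A B
  assume "A \<in> Obj X" "B \<in> Obj X"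
  then show "deriv (\<zero> A B) = \<zero> (A \<otimes> A) B"
    by (simp add: deriv_eq [of _ A] LS1_Zero)
next
  fix A B f
  assume f: "f \<in> hom X A B"
  then have A: "A \<in> Obj X" "B \<in> Obj X" by auto
  show "deriv f \<in> hom X (A \<otimes> A) B" using f by simp
  show "(\<one> A \<boxtimes> sum_map A) \<cdot> deriv f =
      (\<one> A \<boxtimes> \<pi>\<^sub>0 A A) \<cdot> deriv f \<oplus> (\<one> A \<boxtimes> \<pi>\<^sub>1 A A) \<cdot> deriv f"
    unfolding deriv_eq [OF f [simplified, THEN conjunct2, THEN conjunct1]]
    by (rule LS2_Add) (use f A in simp_all)
  show "\<langle>\<one> A, \<zero> A A\<rangle> \<cdot> deriv f = \<zero> A B"
    using f A by (simp add: deriv_eq [of _ A] LS_zero_argument)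
  show "lift_map A A A A \<cdot> deriv (deriv f) = deriv f" using f by (rule deriv_lift)
  show "interchange A A A A \<cdot> deriv (deriv f) = deriv (deriv f)" using f by (rule deriv_interchange)
next
  have const: "LS A A (\<pi>\<^sub>0 A A) = \<zero> (A \<otimes> A) A" if "A \<in> Obj X" for A
    using LS_const [of A A "\<one> A"] that by simp
  fix A assume A: "A \<in> Obj X"
  then show "deriv (\<one> A) = \<pi>\<^sub>1 A A"
    by (simp add: deriv_eq [of _ A] LS1_Add [of _ _ _ A] const LS3_Proj1)
  fix B assume B: "B \<in> Obj X"
  show "deriv (\<pi>\<^sub>0 A B) = \<pi>\<^sub>1 (A \<otimes> B) (A \<otimes> B) \<cdot> \<pi>\<^sub>0 A B"
    using A B by (simp add: deriv_eq [of _ "A \<otimes> B"] LS1_Add [of _ _ _ A] LS_const LS3_Proj1_Proj0)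
  show "deriv (\<pi>\<^sub>1 A B) = \<pi>\<^sub>1 (A \<otimes> B) (A \<otimes> B) \<cdot> \<pi>\<^sub>1 A B"
    using A B by (simp add: deriv_eq [of _ "A \<otimes> B"] LS1_Add [of _ _ _ B] LS_const LS3_Proj1_Proj1)
next
  fix Z A B f g
  assume fg: "f \<in> hom X Z A" "g \<in> hom X Z B"
  then have "A \<in> Obj X" "B \<in> Obj X" "Z \<in> Obj X" by auto
  with fg show "deriv \<langle>f, g\<rangle> = \<langle>deriv f, deriv g\<rangle>"
    by (simp add: deriv_eq [of _ Z] LS4 [of _ _ _ A _ B])
next
  fix A B C f g
  assume "f \<in> hom X A B" "g \<in> hom X B C"
  then show "deriv (f \<cdot> g) = \<langle>\<pi>\<^sub>0 A A \<cdot> f, deriv f\<rangle> \<cdot> deriv g" by (rule deriv_chain)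
qed

end

section \<open>Composition with linear maps\<close>

context linearizing_combinator
begin

lemma L_type [simp]:
  assumes "f \<in> Arr X"
  shows "L f \<in> Arr X" "Dom X (L f) = Dom X f" "Cod X (L f) = Cod X f"
  using L_hom [of f "Dom X f" "Cod X f"] assms by simp_all

text \<open>
  By the chain rule the linear part factors through the zero map, and linear parts are additive.
\<close>

lemma L_const:
  assumes "A \<in> Obj X" "k \<in> Arr X" "Dom X k = B"
  shows "L (\<zero> A B \<cdot> k) = \<zero> A (Cod X k)"
proof -
  have [simp]: "B \<in> Obj X" using assms by auto
  let ?h = "(\<one> B \<oplus> \<zero> B A \<cdot> \<zero> A B) \<cdot> k"
  have "additive (L ?h)" by (rule L2 [of _ B "Cod X k"]) (use assms in simp)
  moreover have "L (\<zero> A B \<cdot> k) = \<zero> A B \<cdot> L ?h"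
    using L5 [of "\<zero> A B" A B k "Cod X k"] assms by (simp add: L1_Zero)
  ultimately show ?thesis using assms by (simp add: additive_Zero)
qed

text \<open>
  As \<open>g\<close> is additive, \<open>(1 + 0 f) g\<close> is \<open>g\<close> plus a constant, and a constant has linear part \<open>0\<close>.
\<close>

lemma L_postcompose_linear:
  assumes "f \<in> hom X A B" "g \<in> hom X B C" "L g = g"
  shows "L (f \<cdot> g) = L f \<cdot> g"
proof -
  have [simp]: "A \<in> Obj X" "B \<in> Obj X" "C \<in> Obj X" using assms by auto
  have "additive g" using L2 [OF assms(2)] by (simp only: assms(3))
  then have "(\<one> B \<oplus> \<zero> B A \<cdot> f) \<cdot> g = g \<oplus> \<zero> B A \<cdot> (f \<cdot> g)"
    using assms(1,2) by (simp add: additive_Add)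
  then show ?thesis
    using assms L5 [OF assms(1,2)]
    by (simp add: L1_Add [of _ B C] L_const)
qed

end

section \<open>The closed system of an exponentiable linearizing combinator\<close>

context exponentiable_linearizing_combinator
begin

abbreviation LS :: "'o \<Rightarrow> 'o \<Rightarrow> 'm \<Rightarrow> 'm"
  where "LS \<equiv> lin_system L"

lemma lin_system_type [simp]:
  assumes "C \<in> Obj X" "A \<in> Obj X" "f \<in> Arr X" "Dom X f = C \<otimes> A"
  shows "LS C A f \<in> Arr X" "Dom X (LS C A f) = C \<otimes> A" "Cod X (LS C A f) = Cod X f"
  using assms by (simp_all add: lin_system_def)

text \<open>
  Equations between linear parts with a parameter are checked after currying, where they become
  equations about \<open>L\<close>.
\<close>

lemma Curry_LS:
  assumes "C \<in> Obj X" "A \<in> Obj X" "f \<in> Arr X" "Dom X f = C \<otimes> A"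
  shows "\<Lambda> C A (LS C A f) = L (\<Lambda> C A f)"
  using assms by (simp add: lin_system_def)

lemma LS_eqI:
  assumes "C \<in> Obj X" "A \<in> Obj X" "f \<in> Arr X" "Dom X f = C \<otimes> A"
    "g \<in> hom X (C \<otimes> A) (Cod X f)" "\<Lambda> C A g = L (\<Lambda> C A f)"
  shows "LS C A f = g"
  by (rule Curry_eqI [of C A _ "Cod X f"]) (use assms in \<open>simp_all add: Curry_LS\<close>)

lemma L_exp_map:
  assumes "h \<in> Arr X" "g \<in> Arr X" "L g = g"
  shows "L (exp_map h g) = exp_map h g"
  using EL2 [of h "Dom X h" "Cod X h" g "Dom X g" "Cod X g"] assms by simp

lemma L_exp_prod:
  assumes "C \<in> Obj X" "A \<in> Obj X" "D \<in> Obj X"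
  shows "L (exp_prod C A D) = exp_prod C A D"
  unfolding exp_prod_def
  using assms
  by (subst L_postcompose_linear [where B = "\<^bold>[C \<otimes> A, \<^bold>[C \<otimes> A, D\<^bold>]\<^bold>]" and C = "\<^bold>[C \<otimes> A, D\<^bold>]"])
    (simp_all add: EL1_mult L_exp_map L3_Ident)

lemma LS_postcompose_linear:
  assumes "C \<in> Obj X" "A \<in> Obj X" "f \<in> hom X (C \<otimes> A) B" "g \<in> hom X B D" "L g = g"
  shows "LS C A (f \<cdot> g) = LS C A f \<cdot> g"
proof (rule LS_eqI)
  have [simp]: "B \<in> Obj X" "D \<in> Obj X" using assms by auto
  have "\<Lambda> C A (LS C A f \<cdot> g) = L (\<Lambda> C A f) \<cdot> exp_map (\<one> C) g"
    using assms Curry_exp_map [of A "\<one> C" C C g B D "LS C A f"] by (simp add: Curry_LS)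
  also have "\<dots> = L (\<Lambda> C A f \<cdot> exp_map (\<one> C) g)"
    using assms
    by (subst L_postcompose_linear [where A = A and B = "\<^bold>[C, B\<^bold>]" and C = "\<^bold>[C, D\<^bold>]"])
      (simp_all add: L_exp_map)
  also have "\<Lambda> C A f \<cdot> exp_map (\<one> C) g = \<Lambda> C A (f \<cdot> g)"
    using assms Curry_exp_map [of A "\<one> C" C C g B D f] by simp
  finally show "\<Lambda> C A (LS C A f \<cdot> g) = L (\<Lambda> C A (f \<cdot> g))" .
qed (use assms in simp_all)

lemma LS_precompose:
  assumes "A \<in> Obj X" "h \<in> hom X C' C" "f \<in> hom X (C \<otimes> A) B"
  shows "LS C' A ((h \<boxtimes> \<one> A) \<cdot> f) = (h \<boxtimes> \<one> A) \<cdot> LS C A f"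
proof (rule LS_eqI)
  have [simp]: "C \<in> Obj X" "C' \<in> Obj X" "B \<in> Obj X" using assms by auto
  show "C' \<in> Obj X" by simp
  have "\<Lambda> C' A ((h \<boxtimes> \<one> A) \<cdot> LS C A f) = L (\<Lambda> C A f) \<cdot> exp_map h (\<one> B)"
    using assms Curry_exp_map [of A h C' C "\<one> B" B B "LS C A f"] by (simp add: Curry_LS)
  also have "\<dots> = L (\<Lambda> C A f \<cdot> exp_map h (\<one> B))"
    using assms
    by (subst L_postcompose_linear [where A = A and B = "\<^bold>[C, B\<^bold>]" and C = "\<^bold>[C', B\<^bold>]"])
      (simp_all add: L_exp_map L3_Ident)
  also have "\<Lambda> C A f \<cdot> exp_map h (\<one> B) = \<Lambda> C' A ((h \<boxtimes> \<one> A) \<cdot> f)"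
    using assms Curry_exp_map [of A h C' C "\<one> B" B B f] by simp
  finally show "\<Lambda> C' A ((h \<boxtimes> \<one> A) \<cdot> LS C A f) = L (\<Lambda> C' A ((h \<boxtimes> \<one> A) \<cdot> f))" .
  show "(h \<boxtimes> \<one> A) \<cdot> f \<in> Arr X" "Dom X ((h \<boxtimes> \<one> A) \<cdot> f) = C' \<otimes> A"
    "(h \<boxtimes> \<one> A) \<cdot> LS C A f \<in> hom X (C' \<otimes> A) (Cod X ((h \<boxtimes> \<one> A) \<cdot> f))"
    using assms by simp_all
qed (use assms in simp_all)

lemma LS_Proj1_Comp:
  assumes "C \<in> Obj X" "g \<in> hom X A B"
  shows "LS C A (\<pi>\<^sub>1 C A \<cdot> g) = \<pi>\<^sub>1 C A \<cdot> L g"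
proof (rule LS_eqI)
  have [simp]: "A \<in> Obj X" "B \<in> Obj X" using assms by auto
  have "\<Lambda> C A (\<pi>\<^sub>1 C A \<cdot> L g) = L g \<cdot> exp_unit C B"
    using assms by (subst Curry_exp_unit [of _ _ A]) simp_all
  also have "\<dots> = L (g \<cdot> exp_unit C B)"
    using assms by (subst L_postcompose_linear [where A = A and B = B and C = "\<^bold>[C, B\<^bold>]"])
      (simp_all add: EL1_unit)
  also have "g \<cdot> exp_unit C B = \<Lambda> C A (\<pi>\<^sub>1 C A \<cdot> g)"
    using assms by (rule Curry_exp_unit)
  finally show "\<Lambda> C A (\<pi>\<^sub>1 C A \<cdot> L g) = L (\<Lambda> C A (\<pi>\<^sub>1 C A \<cdot> g))" .
  show "A \<in> Obj X" "\<pi>\<^sub>1 C A \<cdot> g \<in> Arr X" "Dom X (\<pi>\<^sub>1 C A \<cdot> g) = C \<otimes> A"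
    "\<pi>\<^sub>1 C A \<cdot> L g \<in> hom X (C \<otimes> A) (Cod X (\<pi>\<^sub>1 C A \<cdot> g))"
    using assms by simp_all
qed (rule assms)

lemma LS_Pair:
  assumes "C \<in> Obj X" "A \<in> Obj X" "f \<in> hom X (C \<otimes> A) B" "g \<in> hom X (C \<otimes> A) D"
  shows "LS C A \<langle>f, g\<rangle> = \<langle>LS C A f, LS C A g\<rangle>"
proof (rule Pair_eqI [of B D _ "C \<otimes> A"])
  show [simp]: "B \<in> Obj X" "D \<in> Obj X" using assms by auto
  show "LS C A \<langle>f, g\<rangle> \<cdot> \<pi>\<^sub>0 B D = \<langle>LS C A f, LS C A g\<rangle> \<cdot> \<pi>\<^sub>0 B D"
    using assms LS_postcompose_linear [of C A "\<langle>f, g\<rangle>" "B \<otimes> D" "\<pi>\<^sub>0 B D" B]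
    by (simp add: L3_Proj0)
  show "LS C A \<langle>f, g\<rangle> \<cdot> \<pi>\<^sub>1 B D = \<langle>LS C A f, LS C A g\<rangle> \<cdot> \<pi>\<^sub>1 B D"
    using assms LS_postcompose_linear [of C A "\<langle>f, g\<rangle>" "B \<otimes> D" "\<pi>\<^sub>1 B D" D]
    by (simp add: L3_Proj1)
qed (use assms in simp_all)

text \<open>
  In Kleisli form the composite is \<open>\<Lambda> f\<close> followed by the Kleisli extension of \<open>\<Lambda> g\<close>, and the
  chain rule for \<open>L\<close> applies to it. The translation \<open>1 + 0 (\<Lambda> f)\<close> that it introduces can be absorbed
  into \<open>g\<close>, which becomes \<open>h\<close>; and \<open>L\<close> commutes with Kleisli extension because the functorial action and
  the multiplication are preserved.
\<close>

lemma LS_chain: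
  assumes "C \<in> Obj X" "A \<in> Obj X" "B \<in> Obj X" "f \<in> hom X (C \<otimes> A) B" "g \<in> hom X (C \<otimes> B) D"
  defines "h \<equiv> \<langle>\<pi>\<^sub>0 C B, \<pi>\<^sub>1 C B \<oplus> \<langle>\<pi>\<^sub>0 C B, \<zero> (C \<otimes> B) A\<rangle> \<cdot> f\<rangle> \<cdot> g"
  shows "LS C A (\<langle>\<pi>\<^sub>0 C A, f\<rangle> \<cdot> g) = \<langle>\<pi>\<^sub>0 C A, LS C A f\<rangle> \<cdot> LS C B h"
proof (rule LS_eqI)
  have [simp]: "D \<in> Obj X" using assms by auto
  have h: "h \<in> hom X (C \<otimes> B) D" using assms by (simp add: h_def)
  \<comment> \<open>The Kleisli extension of \<open>\<Lambda> k\<close>.\<close>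
  let ?E = "\<lambda>k. exp_map (\<one> C) (\<Lambda> C B k) \<cdot> exp_mult C D"
  let ?m = "\<one> \<^bold>[C, B\<^bold>] \<oplus> \<zero> \<^bold>[C, B\<^bold>] A \<cdot> \<Lambda> C A f"
  have E: "?E k \<in> hom X \<^bold>[C, B\<^bold>] \<^bold>[C, D\<^bold>]" if "k \<in> hom X (C \<otimes> B) D" for k
    using assms(1-3) that by simp
  have "\<Lambda> C A (\<langle>\<pi>\<^sub>0 C A, f\<rangle> \<cdot> g) = \<Lambda> C A f \<cdot> ?E g"
    using assms(1-5) Curry_Kleisli [of C "\<Lambda> C A f" A B g D] by simp
  then have "L (\<Lambda> C A (\<langle>\<pi>\<^sub>0 C A, f\<rangle> \<cdot> g)) = L (\<Lambda> C A f) \<cdot> L (?m \<cdot> ?E g)"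
    using L5 [OF _ E [OF assms(5)], of "\<Lambda> C A f" A] assms(1-5)
    by (simp del: Comp_Curry Comp_Curry_Comp)
  also have "?m \<cdot> ?E g = ?E h"
  proof -
    have "uncurry C B (\<zero> \<^bold>[C, B\<^bold>] A \<cdot> \<Lambda> C A f) = \<langle>\<pi>\<^sub>0 C \<^bold>[C, B\<^bold>], \<zero> (C \<otimes> \<^bold>[C, B\<^bold>]) A\<rangle> \<cdot> f"
      using assms(1-5) by simp
    moreover have "uncurry C B (\<one> \<^bold>[C, B\<^bold>]) = \<epsilon> C B"
      using assms(1-3) by (simp add: uncurry_def)
    ultimately have m: "uncurry C B ?m = \<epsilon> C B \<oplus> \<langle>\<pi>\<^sub>0 C \<^bold>[C, B\<^bold>], \<zero> (C \<otimes> \<^bold>[C, B\<^bold>]) A\<rangle> \<cdot> f"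
      using assms(1-5) by (subst uncurry_Add) simp_all
    have "?m \<cdot> ?E g = \<Lambda> C \<^bold>[C, B\<^bold>] (\<langle>\<pi>\<^sub>0 C \<^bold>[C, B\<^bold>], uncurry C B ?m\<rangle> \<cdot> g)"
      by (rule Curry_Kleisli) (use assms(1-5) in simp_all)
    also have "\<dots> = \<Lambda> C \<^bold>[C, B\<^bold>] (\<langle>\<pi>\<^sub>0 C \<^bold>[C, B\<^bold>], uncurry C B (\<one> \<^bold>[C, B\<^bold>])\<rangle> \<cdot> h)"
      unfolding m using assms(1-5) by (simp add: h_def uncurry_def)
    also have "\<dots> = \<one> \<^bold>[C, B\<^bold>] \<cdot> ?E h"
      by (rule Curry_Kleisli [symmetric]) (use assms(1-3) h in simp_all)
    also have "\<dots> = ?E h" using E [OF h] by simp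
    finally show ?thesis .
  qed
  also have "L (?E h) = ?E (LS C B h)"
  proof -
    have "L (?E h) = L (exp_map (\<one> C) (\<Lambda> C B h)) \<cdot> exp_mult C D"
      by (rule L_postcompose_linear [where A = "\<^bold>[C, B\<^bold>]"])
        (use assms(1-3) h in \<open>simp_all add: EL1_mult\<close>)
    also have "L (exp_map (\<one> C) (\<Lambda> C B h)) = exp_map (\<one> C) (\<Lambda> C B (LS C B h))"
      using assms(1-3) h EL2 [of "\<one> C" C C "\<Lambda> C B h" B "\<^bold>[C, D\<^bold>]"] by (simp add: Curry_LS)
    finally show ?thesis .
  qed
  also have "L (\<Lambda> C A f) \<cdot> ?E (LS C B h) = \<Lambda> C A (\<langle>\<pi>\<^sub>0 C A, LS C A f\<rangle> \<cdot> LS C B h)"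
    using assms(1-4) h Curry_Kleisli [of C "L (\<Lambda> C A f)" A B "LS C B h" D]
    by (simp add: lin_system_def)
  finally show "\<Lambda> C A (\<langle>\<pi>\<^sub>0 C A, LS C A f\<rangle> \<cdot> LS C B h) = L (\<Lambda> C A (\<langle>\<pi>\<^sub>0 C A, f\<rangle> \<cdot> g))" ..
  show "\<langle>\<pi>\<^sub>0 C A, f\<rangle> \<cdot> g \<in> Arr X" "Dom X (\<langle>\<pi>\<^sub>0 C A, f\<rangle> \<cdot> g) = C \<otimes> A"
    "\<langle>\<pi>\<^sub>0 C A, LS C A f\<rangle> \<cdot> LS C B h \<in> hom X (C \<otimes> A) (Cod X (\<langle>\<pi>\<^sub>0 C A, f\<rangle> \<cdot> g))"
    using assms(1-5) h by simp_all
qed (use assms in simp_all)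

text \<open>
  Linearizing in \<open>B\<close> with parameters \<open>C\<close> and \<open>A\<close> gives the same result whether the two are
  treated as one parameter \<open>C \<otimes> A\<close> or \<open>C\<close> is curried away first, since the comparison
  map \<open>exp_prod\<close> is linear.
\<close>

lemma Curry_sys_lin1:
  assumes "C \<in> Obj X" "A \<in> Obj X" "B \<in> Obj X" "k \<in> hom X (C \<otimes> (A \<otimes> B)) D"
  shows "\<Lambda> C (A \<otimes> B) (sys_lin1 LS C A B k) = LS A B (\<Lambda> C (A \<otimes> B) k)"
proof -
  have [simp]: "D \<in> Obj X" using assms by auto
  define i where "i = iso_inv (assoc_map C A B)"
  note i_eq = i_def [unfolded iso_inv_assoc_map [OF assms(1-3)]]
  have i: "i \<in> hom X ((C \<otimes> A) \<otimes> B) (C \<otimes> (A \<otimes> B))" using assms(1-3) by (simp add: i_eq)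
  define m where "m = uncurry C D (LS A B (\<Lambda> C (A \<otimes> B) k))"
  have m: "m \<in> hom X (C \<otimes> (A \<otimes> B)) D" "\<Lambda> C (A \<otimes> B) m = LS A B (\<Lambda> C (A \<otimes> B) k)"
    using assms by (simp_all add: m_def)
  have "\<Lambda> (C \<otimes> A) B (i \<cdot> m) = \<Lambda> A B (\<Lambda> C (A \<otimes> B) m) \<cdot> exp_prod C A D"
    using assms m(1) by (simp only: Curry_Curry_exp_prod i_def)
  also have "\<dots> = L (\<Lambda> A B (\<Lambda> C (A \<otimes> B) k)) \<cdot> exp_prod C A D"
    using assms by (simp add: Curry_LS m(2))
  also have "\<dots> = L (\<Lambda> A B (\<Lambda> C (A \<otimes> B) k) \<cdot> exp_prod C A D)"
    by (rule L_postcompose_linear [symmetric])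
      (use assms in \<open>simp_all add: L_exp_prod\<close>)
  also have "\<dots> = L (\<Lambda> (C \<otimes> A) B (i \<cdot> k))"
    using assms by (simp only: Curry_Curry_exp_prod i_def)
  finally have "LS (C \<otimes> A) B (i \<cdot> k) = i \<cdot> m"
    by (intro LS_eqI) (use assms i m(1) in simp_all)
  then have "sys_lin1 LS C A B k = assoc_map C A B \<cdot> (i \<cdot> m)"
    by (simp add: sys_lin1_def i_def [symmetric])
  also have "\<dots> = m"
    using assms(1-3) m(1) by (simp add: i_eq assoc_map_def)
  finally show ?thesis by (simp only: m(2))
qed

text \<open>
  The two partial linearizations differ by exchanging the arguments \<open>A\<close> and \<open>B\<close>, and currying in
  \<open>C\<close> commutes with this exchange.
\<close>

lemma Curry_sys_lin0:
  assumes "C \<in> Obj X" "A \<in> Obj X" "B \<in> Obj X" "k \<in> hom X (C \<otimes> (A \<otimes> B)) D"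
  shows "\<Lambda> C (A \<otimes> B) (sys_lin0 LS C A B k) = lin0 L A B (\<Lambda> C (A \<otimes> B) k)"
proof -
  have [simp]: "D \<in> Obj X" using assms by auto
  let ?k = "(\<one> C \<boxtimes> twist B A) \<cdot> k"
  have k: "?k \<in> hom X (C \<otimes> (B \<otimes> A)) D" using assms by (simp add: twist_def)
  have "sys_lin1 LS C B A ?k \<in> hom X (C \<otimes> (B \<otimes> A)) D"
    using assms by (simp add: sys_lin1_eq twist_def)
  note lin1 = this [simplified]
  have "sys_lin0 LS C A B k = (\<one> C \<boxtimes> twist A B) \<cdot> sys_lin1 LS C B A ?k"
    using assms by (simp add: sys_lin0_eq sys_lin1_eq twist_def)
  then have "\<Lambda> C (A \<otimes> B) (sys_lin0 LS C A B k) = twist A B \<cdot> \<Lambda> C (B \<otimes> A) (sys_lin1 LS C B A ?k)"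
    using assms lin1 by (simp add: twist_def)
  also have "\<dots> = twist A B \<cdot> LS B A (twist B A \<cdot> \<Lambda> C (A \<otimes> B) k)"
    using Curry_sys_lin1 [OF assms(1,3,2) k] assms by (simp add: twist_def)
  also have "\<dots> = lin0 L A B (\<Lambda> C (A \<otimes> B) k)"
    using assms by (simp add: lin0_def lin_system_def twist_def)
  finally show ?thesis .
qed

lemma sys_lin_type:
  assumes "C \<in> Obj X" "A \<in> Obj X" "B \<in> Obj X" "k \<in> hom X (C \<otimes> (A \<otimes> B)) D"
  shows "sys_lin0 LS C A B k \<in> hom X (C \<otimes> (A \<otimes> B)) D"
    "sys_lin1 LS C A B k \<in> hom X (C \<otimes> (A \<otimes> B)) D"
  using assms by (simp_all add: sys_lin0_eq sys_lin1_eq)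

lemma LS_sys_lin_commute:
  assumes "C \<in> Obj X" "A \<in> Obj X" "B \<in> Obj X" "k \<in> hom X (C \<otimes> (A \<otimes> B)) D"
  shows "sys_lin1 LS C A B (sys_lin0 LS C A B k) = sys_lin0 LS C A B (sys_lin1 LS C A B k)"
proof (rule Curry_eqI)
  have lin1: "lin1 L A B f = LS A B f" for f by (simp add: lin1_def lin_system_def)
  note t = sys_lin_type [OF assms]
  have "\<Lambda> C (A \<otimes> B) k \<in> hom X (A \<otimes> B) \<^bold>[C, D\<^bold>]" using assms by simp
  note EL3 [OF assms(2,3) this]
  then show "\<Lambda> C (A \<otimes> B) (sys_lin1 LS C A B (sys_lin0 LS C A B k)) =
      \<Lambda> C (A \<otimes> B) (sys_lin0 LS C A B (sys_lin1 LS C A B k))"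
    by (simp only: lin1 Curry_sys_lin1 [OF assms] Curry_sys_lin0 [OF assms]
        Curry_sys_lin1 [OF assms(1-3) t(1)] Curry_sys_lin0 [OF assms(1-3) t(2)])
  show "sys_lin1 LS C A B (sys_lin0 LS C A B k) \<in> hom X (C \<otimes> (A \<otimes> B)) D"
    "sys_lin0 LS C A B (sys_lin1 LS C A B k) \<in> hom X (C \<otimes> (A \<otimes> B)) D"
    using sys_lin_type [OF assms(1-3)] t by blast+
qed (use assms in simp_all)

text \<open>
  Additivity in the linear argument is additivity of \<open>L (\<Lambda> f)\<close>, uncurried. Since the unit is
  linear, a map that does not depend on the parameter has the linear part that \<open>L\<close> assigns to it, which gives
  the axioms on projections.
\<close>

lemma closed_linearizing_system_LS: "closed_linearizing_system X LS"
proof unfold_locales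
  fix C A f B g
  assume CA: "C \<in> Obj X" "A \<in> Obj X" and f: "f \<in> hom X (C \<otimes> A) B"
  then have [simp]: "B \<in> Obj X" by auto
  show "LS C A f \<in> hom X (C \<otimes> A) B" using CA f by simp
  have "additive (L (\<Lambda> C A f))" by (rule L2 [of _ A "\<^bold>[C, B\<^bold>]"]) (use CA f in simp)
  note add = additive_Add [OF this] additive_Zero [OF this]
  have comp: "uncurry C B (h \<cdot> L (\<Lambda> C A f)) = (\<one> C \<boxtimes> h) \<cdot> LS C A f"
    if "h \<in> Arr X" "Cod X h = A" for h
    using CA f that by (simp add: uncurry_Comp lin_system_def)
  have "sum_map A \<cdot> L (\<Lambda> C A f) = \<pi>\<^sub>0 A A \<cdot> L (\<Lambda> C A f) \<oplus> \<pi>\<^sub>1 A A \<cdot> L (\<Lambda> C A f)"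
    unfolding sum_map_def by (rule add) (use CA f in simp_all)
  then have "uncurry C B (sum_map A \<cdot> L (\<Lambda> C A f)) =
      uncurry C B (\<pi>\<^sub>0 A A \<cdot> L (\<Lambda> C A f)) \<oplus> uncurry C B (\<pi>\<^sub>1 A A \<cdot> L (\<Lambda> C A f))"
    using CA f by (simp add: uncurry_Add)
  moreover have "sum_map A \<in> Arr X" "Cod X (sum_map A) = A"
    using CA by (simp_all add: sum_map_def)
  ultimately show "(\<one> C \<boxtimes> sum_map A) \<cdot> LS C A f =
      (\<one> C \<boxtimes> \<pi>\<^sub>0 A A) \<cdot> LS C A f \<oplus> (\<one> C \<boxtimes> \<pi>\<^sub>1 A A) \<cdot> LS C A f"
    using CA by (simp only: comp Proj_type)
  have "uncurry C B (\<zero> A A \<cdot> L (\<Lambda> C A f)) = \<zero> (C \<otimes> A) B"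
    using CA f by (simp add: add)
  then show "\<langle>\<pi>\<^sub>0 C A, \<zero> (C \<otimes> A) A\<rangle> \<cdot> LS C A f = \<zero> (C \<otimes> A) B"
    using CA comp [of "\<zero> A A"] by simp
  show "LS C A (LS C A f) = LS C A f"
    using CA f by (intro LS_eqI) (simp_all add: Curry_LS L6 [of _ A "\<^bold>[C, B\<^bold>]"])
  show "\<langle>\<zero> A \<top>, \<one> A\<rangle> \<cdot> LS \<top> A (\<pi>\<^sub>1 \<top> A \<cdot> \<Lambda> C A f) = \<Lambda> C A (LS C A f)"
    using CA f LS_Proj1_Comp [of \<top> "\<Lambda> C A f" A "\<^bold>[C, B\<^bold>]"]
    by (simp add: Curry_LS del: Comp_Curry)
  assume g: "g \<in> hom X (C \<otimes> A) B"
  show "LS C A (f \<oplus> g) = LS C A f \<oplus> LS C A g"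
    using CA f g Curry_Add [of C A f B g] L1_Add [of "\<Lambda> C A f" A "\<^bold>[C, B\<^bold>]" "\<Lambda> C A g"]
    by (simp add: lin_system_def uncurry_Add)
next
  fix C A B
  assume "C \<in> Obj X" "A \<in> Obj X" "B \<in> Obj X"
  then show "LS C A (\<zero> (C \<otimes> A) B) = \<zero> (C \<otimes> A) B"
    by (simp add: lin_system_def Curry_Zero L1_Zero)
next
  fix C A B assume CA: "C \<in> Obj X" "A \<in> Obj X"
  show "LS C A (\<pi>\<^sub>1 C A) = \<pi>\<^sub>1 C A"
    using LS_Proj1_Comp [of C "\<one> A" A A] CA by (simp add: L3_Ident)
  assume B: "B \<in> Obj X"
  show "LS C (A \<otimes> B) (\<pi>\<^sub>1 C (A \<otimes> B) \<cdot> \<pi>\<^sub>0 A B) = \<pi>\<^sub>1 C (A \<otimes> B) \<cdot> \<pi>\<^sub>0 A B"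
    using LS_Proj1_Comp [of C "\<pi>\<^sub>0 A B" "A \<otimes> B" A] CA B by (simp add: L3_Proj0)
  show "LS C (A \<otimes> B) (\<pi>\<^sub>1 C (A \<otimes> B) \<cdot> \<pi>\<^sub>1 A B) = \<pi>\<^sub>1 C (A \<otimes> B) \<cdot> \<pi>\<^sub>1 A B"
    using LS_Proj1_Comp [of C "\<pi>\<^sub>1 A B" "A \<otimes> B" B] CA B by (simp add: L3_Proj1)
qed (rule LS_Pair LS_chain LS_sys_lin_commute LS_precompose [symmetric]; assumption)+

sublocale closed_linearizing_system X LS
  by (rule closed_linearizing_system_LS)

lemma sys_linearizing_LS:
  assumes "f \<in> hom X A B"
  shows "sys_linearizing LS f = L f"
proof -
  have "A \<in> Obj X" "B \<in> Obj X" using assms by auto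
  then show ?thesis
    using assms LS_Proj1_Comp [of \<top> f A B] by (simp add: sys_linearizing_def)
qed

text \<open>
  The partial derivative is the full derivative in the direction \<open>(0, x)\<close>. The inclusion of this axis is
  linear, so it may be applied before linearizing, which leaves the linear part of \<open>f (c, a + x)\<close> in \<open>x\<close>.
\<close>

lemma partial_deriv_eq_sys_lin1:
  assumes "C \<in> Obj X" "A \<in> Obj X" "f \<in> hom X (C \<otimes> A) B"
  shows "partial_deriv deriv C A f = sys_lin1 LS C A A ((\<one> C \<boxtimes> sum_map A) \<cdot> f)"
proof -
  let ?P = "C \<otimes> A"
  let ?k = "(\<pi>\<^sub>0 ?P ?P \<oplus> \<pi>\<^sub>1 ?P ?P) \<cdot> f"
  let ?i = "\<langle>\<pi>\<^sub>0 ?P A, \<langle>\<zero> (?P \<otimes> A) C, \<pi>\<^sub>1 ?P A\<rangle>\<rangle>"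
  have [simp]: "B \<in> Obj X" using assms by auto
  have "partial_deriv deriv C A f = assoc_map C A A \<cdot> (?i \<cdot> LS ?P ?P ?k)"
    using assms by (simp add: partial_deriv_def deriv_eq [of f ?P] assoc_map_def)
  also have "?i \<cdot> LS ?P ?P ?k = LS ?P A (?i \<cdot> ?k)"
    by (rule LS_inject1 [symmetric]) (use assms in simp_all)
  also have "?i \<cdot> ?k = iso_inv (assoc_map C A A) \<cdot> ((\<one> C \<boxtimes> sum_map A) \<cdot> f)"
  proof -
    have "\<pi>\<^sub>0 ?P A \<oplus> \<langle>\<zero> (?P \<otimes> A) C, \<pi>\<^sub>1 ?P A\<rangle> =
        \<langle>\<pi>\<^sub>0 ?P A \<cdot> \<pi>\<^sub>0 C A, \<pi>\<^sub>0 ?P A \<cdot> \<pi>\<^sub>1 C A \<oplus> \<pi>\<^sub>1 ?P A\<rangle>"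
      by (rule Pair_eqI [of C A _ "?P \<otimes> A"]) (use assms in simp_all)
    then show ?thesis using assms by (simp add: iso_inv_assoc_map sum_map_def)
  qed
  finally show ?thesis by (simp only: sys_lin1_def)
qed

lemma deriv_Curry:
  assumes "C \<in> Obj X" "A \<in> Obj X" "f \<in> hom X (C \<otimes> A) B"
  shows "deriv (\<Lambda> C A f) = \<Lambda> C (A \<otimes> A) (partial_deriv deriv C A f)"
proof -
  have [simp]: "B \<in> Obj X" using assms by auto
  have "deriv (\<Lambda> C A f) = LS A A (\<Lambda> C (A \<otimes> A) ((\<one> C \<boxtimes> sum_map A) \<cdot> f))"
    using assms by (simp add: deriv_eq [of _ A] sum_map_def)
  also have "\<dots> = \<Lambda> C (A \<otimes> A) (sys_lin1 LS C A A ((\<one> C \<boxtimes> sum_map A) \<cdot> f))"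
    by (rule Curry_sys_lin1 [symmetric, of _ _ _ _ B]) (use assms in \<open>simp_all add: sum_map_def\<close>)
  finally show ?thesis using partial_deriv_eq_sys_lin1 [OF assms] by simp
qed

lemma lin_differential_eq:
  "f \<in> Arr X \<Longrightarrow> lin_differential L f = deriv f"
  by (simp add: lin_differential_def sys_differential_def lin_system_def sum_map_def)

text \<open>
  \<open>lin_differential L\<close> and \<open>deriv\<close> are known to agree on arrows only, so each axiom is
  transferred separately.
\<close>

lemma cartesian_closed_differential_category_lin_differential:
  "cartesian_closed_differential_category X (lin_differential L)"
proof -
  interpret differential_combinator X deriv by (rule differential_combinator_deriv)
  have type: "f \<in> Arr X" "Dom X f \<in> Obj X" "Cod X f \<in> Obj X" if "f \<in> hom X A B" for f A B
    using that by auto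
  show ?thesis
  proof unfold_locales
    fix A B f g
    assume fg: "f \<in> hom X A B" "g \<in> hom X A B"
    show "lin_differential L (f \<oplus> g) = lin_differential L f \<oplus> lin_differential L g"
      using fg CD1_Add [OF fg] by (simp add: lin_differential_eq)
  next
    fix A B assume "A \<in> Obj X" "B \<in> Obj X"
    then show "lin_differential L (\<zero> A B) = \<zero> (A \<otimes> A) B"
      "lin_differential L (\<pi>\<^sub>0 A B) = \<pi>\<^sub>1 (A \<otimes> B) (A \<otimes> B) \<cdot> \<pi>\<^sub>0 A B"
      "lin_differential L (\<pi>\<^sub>1 A B) = \<pi>\<^sub>1 (A \<otimes> B) (A \<otimes> B) \<cdot> \<pi>\<^sub>1 A B"
      by (simp_all add: lin_differential_eq CD1_Zero CD3_Proj0 CD3_Proj1)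
  next
    fix A assume "A \<in> Obj X"
    then show "lin_differential L (\<one> A) = \<pi>\<^sub>1 A A"
      by (simp add: lin_differential_eq CD3_Ident)
  next
    fix A B f assume f: "f \<in> hom X A B"
    then have eq: "lin_differential L f = deriv f" "lin_differential L (deriv f) = deriv (deriv f)"
      by (simp_all add: lin_differential_eq)
    show "lin_differential L f \<in> hom X (A \<otimes> A) B"
      unfolding eq using f by (rule CD_hom)
    show "(\<one> A \<boxtimes> sum_map A) \<cdot> lin_differential L f =
        (\<one> A \<boxtimes> \<pi>\<^sub>0 A A) \<cdot> lin_differential L f \<oplus> (\<one> A \<boxtimes> \<pi>\<^sub>1 A A) \<cdot> lin_differential L f"
      unfolding eq using f by (rule CD2_Add)
    show "\<langle>\<one> A, \<zero> A A\<rangle> \<cdot> lin_differential L f = \<zero> A B"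
      unfolding eq using f by (rule CD2_Zero)
    show "lift_map A A A A \<cdot> lin_differential L (lin_differential L f) = lin_differential L f"
      unfolding eq using f by (rule CD6)
    show "interchange A A A A \<cdot> lin_differential L (lin_differential L f) =
        lin_differential L (lin_differential L f)"
      unfolding eq using f by (rule CD7)
  next
    fix Z A B f g assume fg: "f \<in> hom X Z A" "g \<in> hom X Z B"
    then show "lin_differential L \<langle>f, g\<rangle> = \<langle>lin_differential L f, lin_differential L g\<rangle>"
      using CD4 [OF fg] by (simp add: lin_differential_eq)
  next
    fix A B C f g assume fg: "f \<in> hom X A B" "g \<in> hom X B C"
    then have "lin_differential L (f \<cdot> g) = deriv (f \<cdot> g)" "lin_differential L f = deriv f"
      "lin_differential L g = deriv g" by (simp_all add: lin_differential_eq)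
    then show "lin_differential L (f \<cdot> g) = \<langle>\<pi>\<^sub>0 A A \<cdot> f, lin_differential L f\<rangle> \<cdot> lin_differential L g"
      using CD5 [OF fg] by (simp only:)
  next
    fix C A f B assume f: "C \<in> Obj X" "A \<in> Obj X" "f \<in> hom X (C \<otimes> A) B"
    then have "lin_differential L (\<Lambda> C A f) = deriv (\<Lambda> C A f)" "lin_differential L f = deriv f"
      by (simp_all add: lin_differential_eq)
    then show "lin_differential L (\<Lambda> C A f) =
        \<Lambda> C (A \<otimes> A) (partial_deriv (lin_differential L) C A f)"
      using deriv_Curry [OF f] by (simp only: partial_deriv_def)
  qed
qed

end

theorem proposition6p11:
  fixes X :: "('o, 'm, 'x) closed_data_scheme"
    and L :: "'m \<Rightarrow> 'm"
  assumes "cartesian_closed_left_additive_category X"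
    and "exponentiable_linearizing_combinator X L"
  defines "LS \<equiv> cartesian_closed_left_additive_category.lin_system X L"
    and "DL \<equiv> cartesian_closed_left_additive_category.lin_differential X L"
  shows "closed_linearizing_system X LS
      \<and> (\<forall>A \<in> Obj X. \<forall>B \<in> Obj X. \<forall>f \<in> hom X A B.
           cartesian_left_additive_category.sys_linearizing X LS f = L f)
      \<and> cartesian_closed_differential_category X DL
      \<and> (\<forall>A \<in> Obj X. \<forall>B \<in> Obj X. \<forall>f \<in> hom X A B.
           DL f = cartesian_left_additive_category.sys_differential X LS f)"
proof -
  interpret exponentiable_linearizing_combinator X L by (rule assms(2))
  show ?thesis
    unfolding LS_def DL_def
    using closed_linearizing_system_LS sys_linearizing_LS lin_differential_eq
      cartesian_closed_differential_category_lin_differential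
    by auto
qed

end
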